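(* Let $\{P_n\}_{n\ge0}$ be either the monic Charlier family (parameter $\mu>0$) or the monic Meixner family (parameters $\gamma>0$, $0<\mu<1$), let $j\ge1$ be an integer, $\alpha<0$, $\lambda>0$, and let $\{\mathbb{S}_n\}_{n\ge0}$ be the corresponding monic Sobolev-type family. Let $x\in\mathbb{C}$. Then, for $|t|<\mu$, $$G_S(x;t)=G_P(x;t)-\lambda\,R_{j,\lambda,\alpha}(x;t),\qquad R_{j,\lambda,\alpha}(x;t)=\sum_{n\ge1}\frac{\psi_n}{n!}\,\Omega_n\,K_{n-1}^{(0,j)}(x,\alpha)\,t^{n}.$$ In particular $G_S(x;t)$ is analytic in $t$ on $|t|<\mu$, the same disc on which $G_P(x;t)$ is analytic. Equivalently, whenever $x-\alpha\notin\{0,1,\dots,j\}$, for $|t|<\mu$, $$G_S(x;t)=G_P(x;t)-\lambda\sum_{n\ge1}\frac{\psi_n}{n!}\,\Omega_n\,\mathcal{A}_n^{(j)}(x,\alpha)\,P_n(x)\,t^{n}-\lambda t\sum_{n\ge0}\frac{\psi_{n+1}}{(n+1)!}\,\Omega_{n+1}\,\mathcal{B}_{n+1}^{(j)}(x,\alpha)\,P_n(x)\,t^{n}.$$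
   Context: Classical families. $\{P_n\}_{n\ge0}$ is the sequence of monic polynomials ($\deg P_n=n$) orthogonal with respect to $\langle f,g\rangle=\sum_{x=0}^{\infty}f(x)g(x)\rho(x)$, with $\|P_n\|^2=\langle P_n,P_n\rangle$. Charlier case: $\mu>0$, $\rho(x)=e^{-\mu}\mu^x/\Gamma(x+1)$, $\|P_n\|^2=n!\,\mu^n$. Meixner case: $\gamma>0$, $0<\mu<1$, $\rho(x)=\mu^x\Gamma(\gamma+x)/(\Gamma(\gamma)\Gamma(x+1))$, $\|P_n\|^2=n!\,(\gamma)_n\,\mu^n/(1-\mu)^{\gamma+2n}$, where $(\gamma)_n=\Gamma(\gamma+n)/\Gamma(\gamma)$. Notation. $\Delta f(x)=f(x+1)-f(x)$, $\Delta^n=\Delta\circ\Delta^{n-1}$, and $\Delta^jP(\alpha)$ means $\Delta^j P$ evaluated at $\alpha$. $[x]_0=1$, $[x]_k=\prod_{i=0}^{k-1}(x-i)$ for $k\ge1$. For nonnegative integers $i,j$ and $n\ge 0$, $K_n^{(i,j)}(x,y)=\sum_{k=0}^{n}\Delta^iP_k(x)\,\Delta^jP_k(y)/\|P_k\|^2$. Sobolev-type family. $\{\mathbb{S}_n\}_{n\ge0}$ is the sequence of monic polynomials ($\deg\mathbb{S}_n=n$) orthogonal with respect to $\langle f,g\rangle_\lambda=\sum_{x\ge0}f(x)g(x)\rho(x)+\lambda\,\Delta^jf(\alpha)\,\Delta^jg(\alpha)$. For $n\ge1$: $\Omega_n=\Delta^jP_n(\alpha)/\bigl(1+\lambda K_{n-1}^{(j,j)}(\alpha,\alpha)\bigr)$,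 and $$\mathcal{A}_n^{(j)}(x,y)=\frac{j!}{\|P_{n-1}\|^2[x-y]_{j+1}}\sum_{k=0}^j\frac{\Delta^kP_{n-1}(y)}{k!}[x-y]_k,\qquad \mathcal{B}_n^{(j)}(x,y)=-\frac{j!}{\|P_{n-1}\|^2[x-y]_{j+1}}\sum_{k=0}^j\frac{\Delta^kP_{n}(y)}{k!}[x-y]_k.$$ Generating functions. $\psi_n=(-\mu)^{-n}$ (Charlier), $\psi_n=(\mu-1)^n\mu^{-n}$ (Meixner). $G_P(x;t)=\sum_{n\ge0}\frac{\psi_n}{n!}P_n(x)t^n$, which for $|t|<\mu$ equals $e^t(1-t/\mu)^x$ (Charlier) or $(1-t/\mu)^x(1-t)^{-x-\gamma}$ (Meixner); and $G_S(x;t)=\sum_{n\ge0}\frac{\psi_n}{n!}\mathbb{S}_n(x)t^n$. *)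

theory Defs
  imports "HOL-Complex_Analysis.Complex_Analysis" "HOL-Computational_Algebra.Polynomial"
begin

datatype family = Charlier (mu: real) | Meixner (gam: real) (mu: real)

fun admissible :: "family \<Rightarrow> bool" where
  "admissible (Charlier \<mu>) \<longleftrightarrow> \<mu> > 0"
| "admissible (Meixner \<gamma> \<mu>) \<longleftrightarrow> \<gamma> > 0 \<and> 0 < \<mu> \<and> \<mu> < 1"

fun weight :: "family \<Rightarrow> nat \<Rightarrow> real" where
  "weight (Charlier \<mu>) x = exp (- \<mu>) * \<mu> ^ x / Gamma (real x + 1)"
| "weight (Meixner \<gamma> \<mu>) x = \<mu> ^ x * Gamma (\<gamma> + real x) / (Gamma \<gamma> * Gamma (real x + 1))"

fun psi :: "family \<Rightarrow> nat \<Rightarrow> real" where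
  "psi (Charlier \<mu>) n = (- \<mu>) powi (- int n)"
| "psi (Meixner \<gamma> \<mu>) n = (\<mu> - 1) ^ n * \<mu> powi (- int n)"

definition fdiff :: "('a \<Rightarrow> 'a) \<Rightarrow> 'a \<Rightarrow> 'a :: comm_ring_1" where
  "fdiff f x = f (x + 1) - f x"

definition falling :: "'a \<Rightarrow> nat \<Rightarrow> 'a :: comm_ring_1" where
  "falling x k = (\<Prod>i<k. x - of_nat i)"

text \<open>The forms below are real, so all orthogonal polynomials have real coefficients;
  they are evaluated at complex points through the following extension.\<close>

definition cpoly :: "real poly \<Rightarrow> complex \<Rightarrow> complex" where
  "cpoly p = poly (map_poly of_real p)"

definition inner_prod :: "family \<Rightarrow> real poly \<Rightarrow> real poly \<Rightarrow> real" where
  "inner_prod F f g = (\<Sum>x. poly f (real x) * poly g (real x) * weight F x)"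

definition sobolev_prod ::
    "family \<Rightarrow> nat \<Rightarrow> real \<Rightarrow> real \<Rightarrow> real poly \<Rightarrow> real poly \<Rightarrow> real" where
  "sobolev_prod F j \<alpha> lam f g =
     inner_prod F f g + lam * (fdiff ^^ j) (poly f) \<alpha> * (fdiff ^^ j) (poly g) \<alpha>"

definition monic_orthogonal ::
    "(real poly \<Rightarrow> real poly \<Rightarrow> real) \<Rightarrow> (nat \<Rightarrow> real poly) \<Rightarrow> bool" where
  "monic_orthogonal B Q \<longleftrightarrow>
     (\<forall>n. degree (Q n) = n \<and> lead_coeff (Q n) = 1) \<and> (\<forall>m n. m \<noteq> n \<longrightarrow> B (Q m) (Q n) = 0)"

definition norm_sq :: "family \<Rightarrow> (nat \<Rightarrow> real poly) \<Rightarrow> nat \<Rightarrow> real" where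
  "norm_sq F P n = inner_prod F (P n) (P n)"

definition kernel ::
    "family \<Rightarrow> (nat \<Rightarrow> real poly) \<Rightarrow> nat \<Rightarrow> nat \<Rightarrow> nat \<Rightarrow> complex \<Rightarrow> complex \<Rightarrow> complex" where
  "kernel F P i j n x y =
     (\<Sum>k\<le>n. (fdiff ^^ i) (cpoly (P k)) x * (fdiff ^^ j) (cpoly (P k)) y
              / of_real (norm_sq F P k))"

text \<open>\<open>Omega\<close>, \<open>coeff_A\<close> and \<open>coeff_B\<close> are meant for \<open>n \<ge> 1\<close> only; at \<open>n = 0\<close> the index
  \<open>n - 1\<close> is truncated.\<close>

definition Omega :: "family \<Rightarrow> (nat \<Rightarrow> real poly) \<Rightarrow> nat \<Rightarrow> real \<Rightarrow> real \<Rightarrow> nat \<Rightarrow> complex" where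
  "Omega F P j \<alpha> lam n =
     (fdiff ^^ j) (cpoly (P n)) (of_real \<alpha>)
     / (1 + of_real lam * kernel F P j j (n - 1) (of_real \<alpha>) (of_real \<alpha>))"

definition coeff_A ::
    "family \<Rightarrow> (nat \<Rightarrow> real poly) \<Rightarrow> nat \<Rightarrow> nat \<Rightarrow> complex \<Rightarrow> complex \<Rightarrow> complex" where
  "coeff_A F P j n x y =
     fact j / (of_real (norm_sq F P (n - 1)) * falling (x - y) (j + 1))
     * (\<Sum>k\<le>j. (fdiff ^^ k) (cpoly (P (n - 1))) y / fact k * falling (x - y) k)"

definition coeff_B ::
    "family \<Rightarrow> (nat \<Rightarrow> real poly) \<Rightarrow> nat \<Rightarrow> nat \<Rightarrow> complex \<Rightarrow> complex \<Rightarrow> complex" where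
  "coeff_B F P j n x y =
     - (fact j / (of_real (norm_sq F P (n - 1)) * falling (x - y) (j + 1)))
     * (\<Sum>k\<le>j. (fdiff ^^ k) (cpoly (P n)) y / fact k * falling (x - y) k)"

definition gen_term ::
    "family \<Rightarrow> (nat \<Rightarrow> real poly) \<Rightarrow> complex \<Rightarrow> complex \<Rightarrow> nat \<Rightarrow> complex" where
  "gen_term F Q x t n = of_real (psi F n) / fact n * cpoly (Q n) x * t ^ n"

definition gen_fun :: "family \<Rightarrow> (nat \<Rightarrow> real poly) \<Rightarrow> complex \<Rightarrow> complex \<Rightarrow> complex" where
  "gen_fun F Q x t = (\<Sum>n. gen_term F Q x t n)"

definition R_term ::
    "family \<Rightarrow> (nat \<Rightarrow> real poly) \<Rightarrow> nat \<Rightarrow> real \<Rightarrow> real \<Rightarrow> complex \<Rightarrow> complex \<Rightarrow> nat \<Rightarrow> complex" where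
  "R_term F P j \<alpha> lam x t n =
     of_real (psi F n) / fact n * Omega F P j \<alpha> lam n * kernel F P 0 j (n - 1) x (of_real \<alpha>) * t ^ n"

definition A_term ::
    "family \<Rightarrow> (nat \<Rightarrow> real poly) \<Rightarrow> nat \<Rightarrow> real \<Rightarrow> real \<Rightarrow> complex \<Rightarrow> complex \<Rightarrow> nat \<Rightarrow> complex" where
  "A_term F P j \<alpha> lam x t n =
     of_real (psi F n) / fact n * Omega F P j \<alpha> lam n * coeff_A F P j n x (of_real \<alpha>)
     * cpoly (P n) x * t ^ n"

definition B_term ::
    "family \<Rightarrow> (nat \<Rightarrow> real poly) \<Rightarrow> nat \<Rightarrow> real \<Rightarrow> real \<Rightarrow> complex \<Rightarrow> complex \<Rightarrow> nat \<Rightarrow> complex" where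
  "B_term F P j \<alpha> lam x t n =
     of_real (psi F (n + 1)) / fact (n + 1) * Omega F P j \<alpha> lam (n + 1)
     * coeff_B F P j (n + 1) x (of_real \<alpha>) * cpoly (P n) x * t ^ n"

text \<open>Series over \<open>n \<ge> 1\<close> are written with \<open>Suc n\<close> in place of \<open>n\<close>.\<close>

definition R_fun ::
    "family \<Rightarrow> (nat \<Rightarrow> real poly) \<Rightarrow> nat \<Rightarrow> real \<Rightarrow> real \<Rightarrow> complex \<Rightarrow> complex \<Rightarrow> complex" where
  "R_fun F P j \<alpha> lam x t = (\<Sum>n. R_term F P j \<alpha> lam x t (Suc n))"

end

theory Submission
  imports Defs
begin

text \<open>
  The identity is algebra; the work is in the convergence of the series on the whole disc.

  Algebra. The polynomial \<open>P n - lam * \<Omega> n * K (n - 1)\<close>, where \<open>K (n - 1)\<close> is the kernel with \<open>j\<close>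
  differences taken in its second argument at \<open>\<alpha>\<close>, is monic and Sobolev-orthogonal to all lower
  degrees, hence equals \<open>S n\<close> (\<open>sobolev_eq\<close>). Multiplying by \<open>psi n / n! * t ^ n\<close> and summing gives
  the first formula. The Christoffel--Darboux formula and a Leibniz rule for differences of a quotient
  rewrite the kernel as \<open>\<A> * P n + \<B> * P (n - 1)\<close> (\<open>kernel_eq_coeff_A_coeff_B\<close>), which gives the
  second one term by term.

  Convergence. Both families have a hypergeometric representation
  \<open>psi n / n! * P n(x) = (\<Sum>k\<le>n. e n k * (-x)\<^sub>k / k!)\<close> with positive \<open>e n k\<close> whose sum over \<open>k\<close> is
  \<open>\<mu> ^ (- n)\<close> up to factors polynomial in \<open>n\<close>; it is identified with \<open>P n\<close> by checking
  orthogonality (\<open>classical_eq_explicit\<close>). Put \<open>X n = \<mu> ^ n * psi n / n! * P n(x)\<close> and let \<open>D n\<close> be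
  \<open>\<mu> ^ n * psi n / n!\<close> times the \<open>j\<close>-th difference of \<open>P n\<close> at \<open>\<alpha>\<close>. Then \<open>X n\<close> and \<open>D n\<close> grow at
  most polynomially. As \<open>\<alpha> < 0\<close>, the sum for \<open>D n\<close> has terms of one sign, so \<open>1 / D n\<close> also grows
  at most polynomially for \<open>n \<ge> j\<close> (\<open>moderate_inverse_scaled_diff\<close>), while \<open>D n = 0\<close> for \<open>n < j\<close>.

  With the positive weights \<open>v k = 1 / ((\<mu> ^ k * psi k / k!)\<^sup>2 * norm_sq k)\<close>, the coefficient of
  \<open>(t / \<mu>) ^ (n + 1)\<close> in the correction term \<open>R\<close> is
  \<open>D (n + 1) * (\<Sum>k\<le>n. X k * D k * v k) / (1 + lam * (\<Sum>k\<le>n. (D k)\<^sup>2 * v k))\<close>.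
  Since \<open>X k\<close> is at most a polynomial times \<open>\<bar>D k\<bar>\<close> for \<open>k \<ge> j\<close>, the quotient is at most a polynomial
  divided by \<open>lam\<close>, and the series converges for \<open>norm t < \<mu>\<close> (\<open>moderate_R\<close>). In the two series of
  the second formula a single \<open>v n\<close> stands over the same denominator, which is at least
  \<open>lam * (D n)\<^sup>2 * v n\<close> (\<open>moderate_weight_over_denom\<close>).
\<close>

section \<open>Sequences of moderate growth\<close>

text \<open>
  Coefficients are measured only up to polynomial factors: a power series in \<open>t / \<mu>\<close> whose
  coefficients are bounded by a polynomial in \<open>n\<close> converges on the whole disc \<open>norm t < \<mu>\<close>,
  and such bounds survive sums, products and index shifts.
\<close>

definition moderate :: "(nat \<Rightarrow> 'a::real_normed_vector) \<Rightarrow> bool" where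
  "moderate f \<longleftrightarrow> (\<exists>C M. \<forall>n. norm (f n) \<le> C * (real n + 1) ^ M)"

lemma moderateI: "(\<And>n. norm (f n) \<le> C * (real n + 1) ^ M) \<Longrightarrow> moderate f"
  unfolding moderate_def by blast

lemma moderateE:
  assumes "moderate f"
  obtains C M where "C \<ge> 0" "\<And>n. norm (f n) \<le> C * (real n + 1) ^ M"
proof -
  obtain C M where *: "\<And>n. norm (f n) \<le> C * (real n + 1) ^ M"
    using assms unfolding moderate_def by blast
  have "C \<ge> 0" using order.trans[OF norm_ge_zero *[of 0]] by simp
  with * that show ?thesis by blast
qed

lemma moderate_le:
  assumes "moderate g" "\<forall>\<^sub>F n in sequentially. norm (f n) \<le> norm (g n)"
  shows "moderate f"
proof -
  obtain C M where C: "C \<ge> 0" "\<And>n. norm (g n) \<le> C * (real n + 1) ^ M"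
    using assms(1) moderateE by blast
  obtain N where N: "\<And>n. n \<ge> N \<Longrightarrow> norm (f n) \<le> norm (g n)"
    using assms(2) unfolding eventually_sequentially by blast
  define D where "D = (\<Sum>i<N. norm (f i))"
  have D: "D \<ge> 0" unfolding D_def by (simp add: sum_nonneg)
  have "norm (f n) \<le> (C + D) * (real n + 1) ^ M" for n
  proof (cases "n \<ge> N")
    case True
    have "norm (f n) \<le> C * (real n + 1) ^ M"
      using N[OF True] C(2)[of n] by linarith
    also have "\<dots> \<le> (C + D) * (real n + 1) ^ M"
      using D by (intro mult_right_mono) auto
    finally show ?thesis .
  next
    case False
    have "norm (f n) \<le> D"
      unfolding D_def by (rule member_le_sum) (use False in auto)
    also have "\<dots> \<le> (C + D) * 1" using C by simp
    also have "\<dots> \<le> (C + D) * (real n + 1) ^ M"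
      using C D by (intro mult_left_mono) auto
    finally show ?thesis .
  qed
  then show ?thesis by (rule moderateI)
qed

lemma moderate_const: "moderate (\<lambda>n. c)"
  by (rule moderateI[of _ "norm c" 0]) simp

lemma moderate_power_Suc: "moderate (\<lambda>n. (real n + 1) ^ M)"
  by (rule moderateI[of _ 1 M]) simp

lemma moderate_of_real_iff:
  "moderate (\<lambda>n. of_real (f n) :: 'a::real_normed_algebra_1) \<longleftrightarrow> moderate f"
  by (simp add: moderate_def)

lemma moderate_add:
  assumes "moderate f" "moderate g"
  shows "moderate (\<lambda>n. f n + g n)"
proof -
  obtain C M where C: "C \<ge> 0" "\<And>n. norm (f n) \<le> C * (real n + 1) ^ M"
    using assms(1) moderateE by blast
  obtain D K where D: "D \<ge> 0" "\<And>n. norm (g n) \<le> D * (real n + 1) ^ K"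
    using assms(2) moderateE by blast
  have "norm (f n + g n) \<le> (C + D) * (real n + 1) ^ (M + K)" for n
  proof -
    have "norm (f n + g n) \<le> C * (real n + 1) ^ M + D * (real n + 1) ^ K"
      using C(2)[of n] D(2)[of n] norm_triangle_ineq[of "f n" "g n"] by linarith
    also have "\<dots> \<le> C * (real n + 1) ^ (M + K) + D * (real n + 1) ^ (M + K)"
      using C D by (intro add_mono mult_left_mono power_increasing) auto
    finally show ?thesis by (simp add: algebra_simps)
  qed
  then show ?thesis by (rule moderateI)
qed

lemma moderate_mult:
  fixes f g :: "nat \<Rightarrow> 'a::real_normed_algebra"
  assumes "moderate f" "moderate g"
  shows "moderate (\<lambda>n. f n * g n)"
proof -
  obtain C M where C: "C \<ge> 0" "\<And>n. norm (f n) \<le> C * (real n + 1) ^ M"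
    using assms(1) moderateE by blast
  obtain D K where D: "D \<ge> 0" "\<And>n. norm (g n) \<le> D * (real n + 1) ^ K"
    using assms(2) moderateE by blast
  have "norm (f n * g n) \<le> (C * D) * (real n + 1) ^ (M + K)" for n
  proof -
    have "norm (f n * g n) \<le> norm (f n) * norm (g n)" by (rule norm_mult_ineq)
    also have "\<dots> \<le> (C * (real n + 1) ^ M) * (D * (real n + 1) ^ K)"
      using C D by (intro mult_mono) auto
    finally show ?thesis by (simp add: power_add algebra_simps)
  qed
  then show ?thesis by (rule moderateI)
qed

lemma moderate_sum:
  assumes "finite A" "\<And>i. i \<in> A \<Longrightarrow> moderate (f i)"
  shows "moderate (\<lambda>n. \<Sum>i\<in>A. f i n)"
  using assms by (induction A rule: finite_induct) (auto simp: moderate_const moderate_add)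

lemma moderate_Suc:
  assumes "moderate f"
  shows "moderate (\<lambda>n. f (Suc n))"
proof -
  obtain C M where C: "C \<ge> 0" "\<And>n. norm (f n) \<le> C * (real n + 1) ^ M"
    using assms moderateE by blast
  have "norm (f (Suc n)) \<le> (C * 2 ^ M) * (real n + 1) ^ M" for n
  proof -
    have "norm (f (Suc n)) \<le> C * (real (Suc n) + 1) ^ M" by (rule C)
    also have "\<dots> \<le> C * (2 * (real n + 1)) ^ M"
      using C by (intro mult_left_mono power_mono) auto
    also have "\<dots> = (C * 2 ^ M) * (real n + 1) ^ M"
      by (simp only: power_mult_distrib mult.assoc)
    finally show ?thesis .
  qed
  then show ?thesis by (rule moderateI)
qed

lemma moderate_poly: "moderate (\<lambda>n. poly p (real n))"
proof (induction p)
  case (pCons a p)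
  have "moderate (\<lambda>n. real n)" by (rule moderateI[of _ 1 1]) simp
  with pCons.IH show ?case
    by (simp add: moderate_add moderate_mult moderate_const)
qed (simp add: moderate_const)

lemma summable_moderate_power:
  fixes f :: "nat \<Rightarrow> 'a::{real_normed_field,banach}"
  assumes "moderate f" "norm z < 1"
  shows "summable (\<lambda>n. f n * z ^ n)"
proof -
  obtain C M where C: "C \<ge> 0" "\<And>n. norm (f n) \<le> C * (real n + 1) ^ M"
    using assms(1) moderateE by blast
  obtain c where c: "norm z < c" "c < 1" using assms(2) dense by blast
  have c0: "c > 0" using c(1) norm_ge_zero[of z] by linarith
  \<comment> \<open>The ratio test, since \<open>((n + 2) / (n + 1)) ^ M\<close> tends to \<open>1\<close>.\<close>
  have "((\<lambda>n. (1 + 1 / real (Suc n)) ^ M * norm z) \<longlonglongrightarrow> (1 + 0) ^ M * norm z)"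
    by (intro tendsto_intros LIMSEQ_Suc[OF lim_1_over_n])
  hence "\<forall>\<^sub>F n in sequentially. (1 + 1 / real (Suc n)) ^ M * norm z < c"
    using c by (intro order_tendstoD(2)) auto
  then obtain N where N: "\<And>n. n \<ge> N \<Longrightarrow> (1 + 1 / real (Suc n)) ^ M * norm z < c"
    unfolding eventually_sequentially by blast
  have sm: "summable (\<lambda>n. (real n + 1) ^ M * norm z ^ n)"
  proof (rule summable_ratio_test[of c N])
    fix n assume "n \<ge> N"
    have "(real (Suc n) + 1) ^ M = (real n + 1) ^ M * (1 + 1 / real (Suc n)) ^ M"
      by (simp add: power_mult_distrib[symmetric] field_simps)
    hence "(real (Suc n) + 1) ^ M * norm z ^ Suc n
        = ((1 + 1 / real (Suc n)) ^ M * norm z) * ((real n + 1) ^ M * norm z ^ n)"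
      by simp
    also have "\<dots> \<le> c * ((real n + 1) ^ M * norm z ^ n)"
      using N[OF \<open>n \<ge> N\<close>] by (intro mult_right_mono) auto
    finally show "norm ((real (Suc n) + 1) ^ M * norm z ^ Suc n)
        \<le> c * norm ((real n + 1) ^ M * norm z ^ n)" by simp
  qed (use c in auto)
  show ?thesis
  proof (rule summable_comparison_test'[where N = 0])
    show "summable (\<lambda>n. C * ((real n + 1) ^ M * norm z ^ n))"
      using sm by (rule summable_mult)
    show "norm (f n * z ^ n) \<le> C * ((real n + 1) ^ M * norm z ^ n)" for n
      using mult_right_mono[OF C(2)[of n], of "norm z ^ n"]
      by (simp add: norm_mult norm_power mult.assoc)
  qed
qed

text \<open>
  Passing from \<open>m\<close> to \<open>m + 1\<close> multiplies the left side by \<open>(b + m) / (m + 1) \<le> 1 + N / (m + 1)\<close>,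
  and by Bernoulli's inequality this is at most the factor \<open>(1 + 1 / (m + 1)) ^ N\<close> gained on the right.
\<close>

lemma pochhammer_over_fact_le:
  fixes b :: real
  assumes "0 \<le> b" "b \<le> real N"
  shows "pochhammer b m / fact m \<le> (real m + 1) ^ N"
proof (induction m)
  case (Suc m)
  have "(real (Suc m) + 1) ^ N = (real m + 1) ^ N * (1 + 1 / (real m + 1)) ^ N"
    by (simp add: power_mult_distrib[symmetric] field_simps)
  moreover have "1 + real N * (1 / (real m + 1)) \<le> (1 + 1 / (real m + 1)) ^ N"
    by (rule Bernoulli_inequality) (simp add: order.trans[of _ 0])
  moreover have "(b + real m) / (real m + 1) \<le> 1 + real N * (1 / (real m + 1))"
  proof -
    have "(b + real m) / (real m + 1) \<le> (real N + (real m + 1)) / (real m + 1)"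
      using assms by (intro divide_right_mono) auto
    thus ?thesis by (simp add: add_divide_distrib)
  qed
  ultimately have *: "(real m + 1) ^ N * ((b + real m) / (real m + 1)) \<le> (real (Suc m) + 1) ^ N"
    by (smt (verit, best) mult_left_mono of_nat_0_le_iff zero_le_power)
  have "pochhammer b (Suc m) / fact (Suc m)
      = pochhammer b m / fact m * ((b + real m) / (real m + 1))"
    by (simp add: pochhammer_Suc field_simps)
  also have "\<dots> \<le> (real m + 1) ^ N * ((b + real m) / (real m + 1))"
    using assms by (intro mult_right_mono[OF Suc.IH]) auto
  finally show ?case using * by linarith
qed simp

text \<open>
  Each factor \<open>(b + i) / (1 + i)\<close> with \<open>i \<ge> 1\<close> is at least \<open>i / (i + 1)\<close>; these telescope
  to \<open>1 / m\<close>, and the factor \<open>b\<close> is left over.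
\<close>

lemma pochhammer_over_fact_ge:
  fixes b :: real
  assumes "b > 0"
  shows "pochhammer b m / fact m \<ge> min 1 b / (real m + 1)"
proof -
  have *: "pochhammer b (Suc m) / fact (Suc m) \<ge> min 1 b / (real m + 1)" for m
  proof (induction m)
    case (Suc m)
    have "min 1 b / (real (Suc m) + 1)
        = min 1 b / (real m + 1) * ((real m + 1) / (real m + 2))"
      by simp
    also have "\<dots> \<le> pochhammer b (Suc m) / fact (Suc m) * ((b + real (Suc m)) / (real m + 2))"
      using assms by (intro mult_mono Suc.IH divide_right_mono)
        (auto intro!: divide_nonneg_nonneg pochhammer_nonneg)
    also have "\<dots> = pochhammer b (Suc (Suc m)) / fact (Suc (Suc m))"
      by (simp add: pochhammer_Suc[of b "Suc m"] field_simps)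
    finally show ?case .
  qed simp
  show ?thesis
  proof (cases m)
    case (Suc k)
    have "min 1 b / (real m + 1) \<le> min 1 b / (real k + 1)"
      using Suc assms by (intro divide_left_mono) auto
    with *[of k] Suc show ?thesis by simp
  qed simp
qed

section \<open>Forward differences\<close>

lemma fdiff_iter_Suc: "(fdiff ^^ Suc k) f x = (fdiff ^^ k) f (x + 1) - (fdiff ^^ k) f x"
  by (simp add: fdiff_def)

lemma fdiff_iter_eq_sum:
  "(fdiff ^^ k) f x = (\<Sum>i\<le>k. (-1) ^ (k + i) * of_nat (k choose i) * f (x + of_nat i))"
proof (induction k arbitrary: x)
  case (Suc k)
  let ?a = "\<lambda>i. (-1) ^ (k + i) * of_nat (k choose i) * f (x + of_nat i)"
  have "(\<Sum>i\<le>Suc k. (-1) ^ (Suc k + i) * of_nat (Suc k choose i) * f (x + of_nat i))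
      = - ?a 0 + (\<Sum>i\<le>k. (-1) ^ (k + i) * of_nat (k choose i) * f (x + of_nat (Suc i)))
        - (\<Sum>i\<le>k. ?a (Suc i))"
    by (subst sum.atMost_Suc_shift)
      (simp add: sum.distrib sum_negf algebra_simps flip: sum_subtractf)
  also have "(\<Sum>i\<le>k. ?a (Suc i)) = (\<Sum>i\<le>Suc k. ?a i) - ?a 0"
    by (subst sum.atMost_Suc_shift) simp
  also have "(\<Sum>i\<le>Suc k. ?a i) = (\<Sum>i\<le>k. ?a i)"
    by (simp add: binomial_eq_0)
  finally show ?case
    unfolding fdiff_iter_Suc Suc.IH by (simp add: algebra_simps)
qed simp

lemma fdiff_iter_of_real:
  assumes "\<And>y. f (of_real y) = of_real (g y)"
  shows "(fdiff ^^ k) f (of_real y :: 'a::{real_algebra_1,comm_ring_1}) = of_real ((fdiff ^^ k) g y)"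
proof -
  have "f (of_real y + of_nat i) = of_real (g (y + of_nat i))" for i
    using assms[of "y + of_nat i"] by simp
  then show ?thesis by (simp add: fdiff_iter_eq_sum)
qed

lemma fdiff_iter_linear:
  "(fdiff ^^ k) (\<lambda>y. \<Sum>i\<in>A. c i * f i y) y = (\<Sum>i\<in>A. c i * (fdiff ^^ k) (f i) y)"
  unfolding fdiff_iter_eq_sum sum_distrib_left
  by (subst sum.swap) (simp add: algebra_simps)

lemma fdiff_iter_poly_eq_0:
  fixes p :: "'a::idom poly"
  assumes "degree p < n"
  shows "(fdiff ^^ n) (poly p) x = 0"
  using assms
proof (induction n arbitrary: p x)
  case (Suc n)
  \<comment> \<open>The leading terms of \<open>p (x + 1)\<close> and \<open>p x\<close> cancel.\<close>
  define q where "q = pcompose p [:1, 1:] - p"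
  have "fdiff (poly p) = poly q"
    by (simp add: q_def fun_eq_iff fdiff_def poly_pcompose add.commute)
  hence *: "(fdiff ^^ Suc n) (poly p) x = (fdiff ^^ n) (poly q) x"
    by (simp only: funpow_Suc_right o_def)
  show ?case
  proof (cases "q = 0")
    case True
    have "fdiff (\<lambda>x::'a. 0) = (\<lambda>x. 0)" by (simp add: fdiff_def fun_eq_iff)
    hence "(fdiff ^^ n) (\<lambda>x::'a. 0) = (\<lambda>x. 0)" by (induction n) auto
    moreover have "poly q = (\<lambda>x. 0)" using True by auto
    ultimately show ?thesis using * by simp
  next
    case False
    have "degree q \<le> degree p" unfolding q_def
      by (rule degree_diff_le) (auto simp: degree_pcompose)
    moreover have "coeff q (degree p) = 0"
      using lead_coeff_comp[of "[:1, 1::'a:]" p] unfolding q_def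
      by (simp add: degree_pcompose)
    ultimately have "degree q < degree p"
      using False by (metis leading_coeff_0_iff order_le_less)
    thus ?thesis using * Suc by simp
  qed
qed simp

text \<open>
  Up to sign the sum is the \<open>n\<close>-th difference of \<open>p\<close>, and each difference lowers the degree. This is
  the source of orthogonality for both families.
\<close>

lemma alternating_binomial_sum_poly_eq_0:
  fixes p :: "real poly"
  assumes "degree p < n"
  shows "(\<Sum>k\<le>n. (-1) ^ k * real (n choose k) * poly p (y + real k)) = 0"
proof -
  have "(-1) ^ n * (\<Sum>k\<le>n. (-1) ^ k * real (n choose k) * poly p (y + real k)) = (fdiff ^^ n) (poly p) y"
    by (simp add: fdiff_iter_eq_sum sum_distrib_left power_add mult.assoc)
  thus ?thesis using fdiff_iter_poly_eq_0[OF assms] by simp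
qed

text \<open>
  The Leibniz rule for differences. It has only two terms because the second difference of the factor
  \<open>z - y\<close> vanishes.
\<close>

lemma fdiff_iter_linear_factor:
  "(fdiff ^^ k) (\<lambda>y. (z - y) * g y) y
     = (z - y - of_nat k) * (fdiff ^^ k) g y - of_nat k * (fdiff ^^ (k - 1)) g y"
proof (induction k arbitrary: y)
  case (Suc k)
  have "of_nat k * ((fdiff ^^ (k - 1)) g (y + 1) - (fdiff ^^ (k - 1)) g y) = of_nat k * (fdiff ^^ k) g y"
    by (cases k) (simp_all add: fdiff_def)
  moreover have "(fdiff ^^ k) g (y + 1) = (fdiff ^^ Suc k) g y + (fdiff ^^ k) g y"
    by (simp add: fdiff_iter_Suc del: funpow.simps)
  ultimately show ?case
    unfolding fdiff_iter_Suc[of k "\<lambda>y. (z - y) * g y"] Suc.IH 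
    by (simp add: algebra_simps del: funpow.simps)
qed simp

lemma falling_Suc: "falling x (Suc k) = falling x k * (x - of_nat k)"
  by (simp add: falling_def)

text \<open>
  With \<open>D k = falling (z - y) (Suc k) * (fdiff ^^ k) g y / fact k\<close>, multiplying the two-term Leibniz
  rule by \<open>falling (z - y) k / fact k\<close> turns it into \<open>D k - D (k - 1)\<close>, so the sum telescopes. The
  lemma expresses differences of a quotient by \<open>z - y\<close> through differences of its numerator, which
  is how the coefficients \<open>\<A>\<close> and \<open>\<B>\<close> arise from the Christoffel--Darboux formula.
\<close>

lemma falling_mult_fdiff_iter:
  fixes g :: "'a::field_char_0 \<Rightarrow> 'a"
  shows "falling (z - y) (Suc j) * (fdiff ^^ j) g y
    = fact j * (\<Sum>k\<le>j. (fdiff ^^ k) (\<lambda>y. (z - y) * g y) y / fact k * falling (z - y) k)"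
proof (induction j)
  case 0
  show ?case by (simp add: falling_def)
next
  case (Suc j)
  let ?h = "\<lambda>k. (fdiff ^^ k) (\<lambda>y. (z - y) * g y) y"
  have nz: "1 + of_nat j \<noteq> (0 :: 'a)"
    by (metis of_nat_Suc of_nat_neq_0)
  have "fact (Suc j) * (\<Sum>k\<le>Suc j. ?h k / fact k * falling (z - y) k)
      = of_nat (Suc j) * (falling (z - y) (Suc j) * (fdiff ^^ j) g y) + falling (z - y) (Suc j) * ?h (Suc j)"
    unfolding Suc.IH
    using nz by (simp add: divide_simps del: funpow.simps)
  also have "?h (Suc j) = (z - y - of_nat (Suc j)) * (fdiff ^^ Suc j) g y - of_nat (Suc j) * (fdiff ^^ j) g y"
    by (subst fdiff_iter_linear_factor) (simp del: funpow.simps)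
  finally show ?case
    by (simp add: falling_Suc[of _ "Suc j"] algebra_simps del: funpow.simps)
qed

section \<open>Orthogonal polynomials for a positive definite form\<close>

lemma monic_sequence_span:
  fixes Q :: "nat \<Rightarrow> 'a::comm_ring_1 poly"
  assumes "\<And>n. degree (Q n) = n \<and> lead_coeff (Q n) = 1"
    and "\<And>i. i \<ge> n \<Longrightarrow> coeff p i = 0"
  shows "\<exists>c. p = (\<Sum>k<n. smult (c k) (Q k))"
  using assms(2)
proof (induction n arbitrary: p)
  case 0
  then show ?case by (simp add: poly_eq_iff)
next
  case (Suc n)
  define q where "q = p - smult (coeff p n) (Q n)"
  have "coeff q i = 0" if "i \<ge> n" for i
  proof (cases "i = n")
    case True
    moreover have "coeff (Q n) n = 1" using assms(1)[of n] by metis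
    ultimately show ?thesis by (simp add: q_def)
  next
    case False
    hence "coeff (Q n) i = 0" using assms(1)[of n] that by (intro coeff_eq_0) auto
    thus ?thesis using False that Suc.prems[of i] by (simp add: q_def)
  qed
  then obtain c where c: "q = (\<Sum>k<n. smult (c k) (Q k))" using Suc.IH by blast
  have "p = (\<Sum>k<Suc n. smult ((c(n := coeff p n)) k) (Q k))"
    using c by (simp add: q_def algebra_simps)
  thus ?case by blast
qed

lemma monic_orthogonal_monic:
  "monic_orthogonal B Q \<Longrightarrow> degree (Q n) = n \<and> lead_coeff (Q n) = 1"
  unfolding monic_orthogonal_def by blast

lemma monic_orthogonal_coeff:
  assumes "monic_orthogonal B Q"
  shows "coeff (Q n) n = 1" "i > n \<Longrightarrow> coeff (Q n) i = 0"
proof -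
  have *: "degree (Q n) = n" "lead_coeff (Q n) = 1"
    using monic_orthogonal_monic[OF assms, of n] by blast+
  show "coeff (Q n) n = 1" using * by metis
  show "i > n \<Longrightarrow> coeff (Q n) i = 0" using * by (intro coeff_eq_0) simp
qed

locale poly_inner_product =
  fixes B :: "real poly \<Rightarrow> real poly \<Rightarrow> real"
  assumes add_left: "B (p + q) r = B p r + B q r"
    and smult_left: "B (smult c p) r = c * B p r"
    and commute: "B p q = B q p"
    and pos: "p \<noteq> 0 \<Longrightarrow> B p p > 0"
begin

lemma zero_left [simp]: "B 0 r = 0"
  using smult_left[of 0 0 r] by simp

lemma diff_left: "B (p - q) r = B p r - B q r"
  using add_left[of "p - q" q r] by simp

lemma sum_left: "B (\<Sum>i\<in>A. f i) r = (\<Sum>i\<in>A. B (f i) r)"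
  by (induction A rule: infinite_finite_induct) (auto simp: add_left)

lemma sum_smult_left: "B (\<Sum>i\<in>A. smult (c i) (f i)) r = (\<Sum>i\<in>A. c i * B (f i) r)"
  by (simp add: sum_left smult_left)

context
  fixes Q assumes Q: "monic_orthogonal B Q"
begin

lemma orthogonal: "m \<noteq> n \<Longrightarrow> B (Q m) (Q n) = 0"
  using Q unfolding monic_orthogonal_def by blast

lemma norm_pos: "B (Q n) (Q n) > 0"
  using monic_orthogonal_coeff(1)[OF Q, of n] by (intro pos) auto

lemma fourier_expansion:
  assumes "\<And>i. i \<ge> n \<Longrightarrow> coeff p i = 0"
  shows "p = (\<Sum>k<n. smult (B p (Q k) / B (Q k) (Q k)) (Q k))"
proof -
  obtain c where c: "p = (\<Sum>k<n. smult (c k) (Q k))"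
    using monic_sequence_span[OF monic_orthogonal_monic[OF Q] assms] by blast
  have "B p (Q m) = c m * B (Q m) (Q m)" if "m < n" for m
  proof -
    have "B p (Q m) = (\<Sum>k<n. c k * B (Q k) (Q m))" by (simp add: c sum_smult_left)
    also have "\<dots> = (\<Sum>k<n. if k = m then c m * B (Q m) (Q m) else 0)"
      by (intro sum.cong) (auto simp: orthogonal)
    also have "\<dots> = c m * B (Q m) (Q m)" using that by (simp add: sum.delta)
    finally show ?thesis .
  qed
  moreover have "B (Q k) (Q k) \<noteq> 0" for k using norm_pos[of k] by simp
  ultimately have "(\<Sum>k<n. smult (B p (Q k) / B (Q k) (Q k)) (Q k)) = (\<Sum>k<n. smult (c k) (Q k))"
    by (intro sum.cong) auto
  thus ?thesis using c by simp
qed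

lemma orthogonal_lower_degree:
  assumes "\<And>i. i \<ge> n \<Longrightarrow> coeff p i = 0"
  shows "B (Q n) p = 0"
proof -
  have "B p (Q n) = (\<Sum>k<n. B p (Q k) / B (Q k) (Q k) * B (Q k) (Q n))"
    using arg_cong[where f = "\<lambda>p. B p (Q n)", OF fourier_expansion[OF assms]]
    by (simp only: sum_smult_left)
  also have "\<dots> = 0" by (intro sum.neutral) (auto simp: orthogonal)
  finally show ?thesis by (simp add: commute)
qed

text \<open>
  The difference \<open>p - Q n\<close> has degree below \<open>n\<close> and is orthogonal to \<open>Q 0, \<dots>, Q (n - 1)\<close>, so
  all its Fourier coefficients vanish.
\<close>

lemma monic_orthogonal_unique:
  assumes "coeff p n = 1" "\<And>i. i > n \<Longrightarrow> coeff p i = 0" "\<And>m. m < n \<Longrightarrow> B p (Q m) = 0"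
  shows "p = Q n"
proof -
  have "coeff (p - Q n) i = 0" if "i \<ge> n" for i
    using assms(1,2) monic_orthogonal_coeff[OF Q] that by (cases "i = n") auto
  hence "p - Q n = (\<Sum>k<n. smult (B (p - Q n) (Q k) / B (Q k) (Q k)) (Q k))"
    by (rule fourier_expansion)
  also have "\<dots> = 0" by (intro sum.neutral) (auto simp: diff_left assms(3) orthogonal)
  finally show ?thesis by simp
qed

text \<open>
  Since multiplication by the variable is symmetric, \<open>X * Q (Suc n)\<close> is orthogonal to every \<open>Q k\<close>
  with \<open>k < n\<close>. The last coefficient follows from
  \<open>B (X * Q (Suc n)) (Q n) = B (Q (Suc n)) (X * Q n)\<close>, as \<open>X * Q n\<close> and \<open>Q (Suc n)\<close> differ by a
  polynomial of lower degree.
\<close>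

lemma three_term_recurrence:
  assumes mult_X: "\<And>p q. B (pCons 0 p) q = B p (pCons 0 q)"
  shows "\<exists>b. pCons 0 (Q (Suc n)) = Q (Suc (Suc n)) + smult b (Q (Suc n))
             + smult (B (Q (Suc n)) (Q (Suc n)) / B (Q n) (Q n)) (Q n)"
proof -
  note Qc = monic_orthogonal_coeff[OF Q]
  define W where "W = pCons 0 (Q (Suc n)) - Q (Suc (Suc n))"
  have "coeff W i = 0" if "i \<ge> Suc (Suc n)" for i
    using that Qc by (cases "i = Suc (Suc n)") (auto simp: W_def coeff_pCons split: nat.splits)
  hence "W = (\<Sum>k<Suc (Suc n). smult (B W (Q k) / B (Q k) (Q k)) (Q k))"
    by (rule fourier_expansion)
  also have "\<dots> = smult (B W (Q n) / B (Q n) (Q n)) (Q n)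
      + smult (B W (Q (Suc n)) / B (Q (Suc n)) (Q (Suc n))) (Q (Suc n))"
  proof -
    have "B W (Q k) = 0" if "k < n" for k
    proof -
      have "coeff (pCons 0 (Q k)) i = 0" if "i \<ge> Suc n" for i
        using that \<open>k < n\<close> Qc by (auto simp: coeff_pCons split: nat.splits)
      hence "B (Q (Suc n)) (pCons 0 (Q k)) = 0" by (rule orthogonal_lower_degree)
      thus ?thesis using that by (simp add: W_def diff_left mult_X orthogonal)
    qed
    thus ?thesis by simp
  qed
  also have "B W (Q n) = B (Q (Suc n)) (Q (Suc n))"
  proof -
    have "coeff (pCons 0 (Q n) - Q (Suc n)) i = 0" if "i \<ge> Suc n" for i
      using that Qc by (cases "i = Suc n") (auto simp: coeff_pCons split: nat.splits)
    hence "B (Q (Suc n)) (pCons 0 (Q n) - Q (Suc n)) = 0" by (rule orthogonal_lower_degree)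
    hence "B (pCons 0 (Q n)) (Q (Suc n)) = B (Q (Suc n)) (Q (Suc n))"
      by (subst (asm) commute) (simp add: diff_left)
    moreover have "B W (Q n) = B (Q (Suc n)) (pCons 0 (Q n))"
      by (simp add: W_def diff_left mult_X orthogonal)
    ultimately show ?thesis
      by (simp add: commute[of "Q (Suc n)" "pCons 0 (Q n)"])
  qed
  finally have "pCons 0 (Q (Suc n)) = Q (Suc (Suc n))
      + smult (B W (Q (Suc n)) / B (Q (Suc n)) (Q (Suc n))) (Q (Suc n))
      + smult (B (Q (Suc n)) (Q (Suc n)) / B (Q n) (Q n)) (Q n)"
    by (simp add: W_def algebra_simps)
  thus ?thesis by blast
qed

end

end

lemma cpoly_0 [simp]: "cpoly 0 x = 0"
  by (simp add: cpoly_def)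

lemma cpoly_pCons [simp]: "cpoly (pCons a p) x = of_real a + x * cpoly p x"
  by (simp add: cpoly_def map_poly_pCons)

lemma cpoly_smult [simp]: "cpoly (smult c p) x = of_real c * cpoly p x"
  by (induction p) (simp_all add: algebra_simps)

lemma cpoly_add [simp]: "cpoly (p + q) x = cpoly p x + cpoly q x"
  by (induction p q rule: poly_induct2) (simp_all add: algebra_simps)

lemma cpoly_diff [simp]: "cpoly (p - q) x = cpoly p x - cpoly q x"
  using cpoly_add[of "p - q" q x] by simp

lemma cpoly_sum [simp]: "cpoly (\<Sum>i\<in>A. f i) x = (\<Sum>i\<in>A. cpoly (f i) x)"
  by (induction A rule: infinite_finite_induct) simp_all

lemma cpoly_of_real: "cpoly p (of_real y) = of_real (poly p y)"
  by (induction p) simp_all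

lemma fdiff_iter_cpoly_of_real:
  "(fdiff ^^ k) (cpoly p) (of_real y) = of_real ((fdiff ^^ k) (poly p) y)"
  by (rule fdiff_iter_of_real) (rule cpoly_of_real)

text \<open>
  Induction on \<open>n\<close> with the three-term recurrence. The coefficient \<open>b\<close> of the recurrence cancels by
  antisymmetry, and its last coefficient \<open>r\<close> is exactly the ratio of consecutive squared norms that
  the normalisation on the left asks for. The points are complex because \<open>x\<close> ranges over the complex
  plane, although the form itself is real.
\<close>

lemma (in poly_inner_product) christoffel_darboux:
  fixes x y :: complex
  assumes Q: "monic_orthogonal B Q" and mult_X: "\<And>p q. B (pCons 0 p) q = B p (pCons 0 q)"
  shows "of_real (B (Q n) (Q n)) * ((x - y) *
           (\<Sum>k\<le>n. cpoly (Q k) x * cpoly (Q k) y / of_real (B (Q k) (Q k))))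
       = cpoly (Q (Suc n)) x * cpoly (Q n) y - cpoly (Q n) x * cpoly (Q (Suc n)) y"
proof (induction n)
  case 0
  have 0: "Q 0 = [:1:]"
    using monic_orthogonal_coeff[OF Q, of 0] by (auto simp: poly_eq_iff coeff_pCons split: nat.splits)
  have "Q (Suc 0) = [:coeff (Q (Suc 0)) 0, 1:]"
    using monic_orthogonal_coeff[OF Q, of "Suc 0"]
    by (auto simp: poly_eq_iff coeff_pCons split: nat.splits)
  then obtain b where 1: "Q (Suc 0) = [:b, 1:]" by blast
  show ?case using norm_pos[OF Q, of 0] by (simp add: 0 1)
next
  case (Suc n)
  define h where "h = (\<lambda>k. B (Q k) (Q k))"
  have h: "h k \<noteq> 0" for k using norm_pos[OF Q, of k] by (simp add: h_def)
  obtain b where "pCons 0 (Q (Suc n)) = Q (Suc (Suc n)) + smult b (Q (Suc n))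
             + smult (h (Suc n) / h n) (Q n)"
    using three_term_recurrence[OF Q mult_X, of n] by (auto simp: h_def)
  hence "cpoly (pCons 0 (Q (Suc n))) z = cpoly (Q (Suc (Suc n)) + smult b (Q (Suc n))
             + smult (h (Suc n) / h n) (Q n)) z" for z by simp
  hence rec: "cpoly (Q (Suc (Suc n))) z = (z - of_real b) * cpoly (Q (Suc n)) z
      - of_real (h (Suc n)) / of_real (h n) * cpoly (Q n) z" for z
    by (simp add: algebra_simps)
  define r where "r = complex_of_real (h (Suc n)) / of_real (h n)"
  define K where "K = (\<Sum>k\<le>n. cpoly (Q k) x * cpoly (Q k) y / of_real (h k))"
  define T where "T = cpoly (Q (Suc n)) x * cpoly (Q (Suc n)) y"
  have r: "of_real (h (Suc n)) = r * of_real (h n)" using h by (simp add: r_def)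
  have "of_real (h (Suc n)) * ((x - y) * (K + T / of_real (h (Suc n))))
      = of_real (h (Suc n)) * ((x - y) * K) + (x - y) * T"
    using h[of "Suc n"] by (simp add: distrib_left)
  also have "of_real (h (Suc n)) * ((x - y) * K) = r * (of_real (h n) * ((x - y) * K))"
    by (simp add: r mult.assoc)
  also have "of_real (h n) * ((x - y) * K)
      = cpoly (Q (Suc n)) x * cpoly (Q n) y - cpoly (Q n) x * cpoly (Q (Suc n)) y"
    using Suc.IH by (simp add: K_def h_def)
  also have "r * \<dots> + (x - y) * T
      = cpoly (Q (Suc (Suc n))) x * cpoly (Q (Suc n)) y
        - cpoly (Q (Suc n)) x * cpoly (Q (Suc (Suc n))) y"
    unfolding rec[folded r_def] T_def by (simp only: algebra_simps)
  finally show ?case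
    by (simp only: K_def T_def h_def sum.atMost_Suc)
qed

section \<open>The Sobolev-type family\<close>

lemma fdiff_iter_poly_sum_smult:
  "(fdiff ^^ j) (poly (\<Sum>i\<in>A. smult (c i) (f i))) y = (\<Sum>i\<in>A. c i * (fdiff ^^ j) (poly (f i)) y)"
proof -
  have "poly (\<Sum>i\<in>A. smult (c i) (f i)) = (\<lambda>y. \<Sum>i\<in>A. c i * poly (f i) y)"
    by (simp add: fun_eq_iff poly_sum)
  thus ?thesis by (simp add: fdiff_iter_linear)
qed

lemma fdiff_iter_poly_smult: "(fdiff ^^ j) (poly (smult c p)) y = c * (fdiff ^^ j) (poly p) y"
  using fdiff_iter_poly_sum_smult[of j "\<lambda>_. c" "\<lambda>_. p" "{()}" y] by simp

lemma fdiff_iter_poly_add: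
  "(fdiff ^^ j) (poly (p + q)) y = (fdiff ^^ j) (poly p) y + (fdiff ^^ j) (poly q) y"
  by (simp add: fdiff_iter_eq_sum algebra_simps sum.distrib)

lemma fdiff_iter_poly_diff:
  "(fdiff ^^ j) (poly (p - q)) y = (fdiff ^^ j) (poly p) y - (fdiff ^^ j) (poly q) y"
  using fdiff_iter_poly_add[of j "p - q" q y] by simp

lemma sobolev_poly_inner_product:
  assumes "poly_inner_product (inner_prod F)" "lam \<ge> 0"
  shows "poly_inner_product (sobolev_prod F j \<alpha> lam)"
proof -
  interpret poly_inner_product "inner_prod F" by fact
  show ?thesis
  proof
    fix p q r :: "real poly" and c
    show "sobolev_prod F j \<alpha> lam (p + q) r = sobolev_prod F j \<alpha> lam p r + sobolev_prod F j \<alpha> lam q r"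
      by (simp add: sobolev_prod_def add_left fdiff_iter_poly_add algebra_simps)
    show "sobolev_prod F j \<alpha> lam (smult c p) r = c * sobolev_prod F j \<alpha> lam p r"
      by (simp add: sobolev_prod_def smult_left fdiff_iter_poly_smult algebra_simps del: poly_smult)
    show "sobolev_prod F j \<alpha> lam p q = sobolev_prod F j \<alpha> lam q p"
      by (simp add: sobolev_prod_def commute)
    have "0 \<le> lam * ((fdiff ^^ j) (poly p) \<alpha> * (fdiff ^^ j) (poly p) \<alpha>)"
      by (intro mult_nonneg_nonneg assms(2) zero_le_square)
    thus "p \<noteq> 0 \<Longrightarrow> sobolev_prod F j \<alpha> lam p p > 0"
      using pos[of p] by (simp add: sobolev_prod_def mult.assoc)
  qed
qed

text \<open>
  The right side \<open>T\<close> is monic. Its \<open>j\<close>-th difference at \<open>\<alpha>\<close> is the quotient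
  \<open>om = dj n / (1 + lam * K)\<close>, and for \<open>m < n\<close> its ordinary product with \<open>P m\<close> is \<open>- lam * om * dj m\<close>;
  the mass term adds \<open>lam * om * dj m\<close>, so \<open>T\<close> is Sobolev-orthogonal to all lower degrees.
  Uniqueness of monic orthogonal polynomials gives \<open>S n = T\<close>.
\<close>

lemma sobolev_eq:
  fixes P S :: "nat \<Rightarrow> real poly" and F j \<alpha> lam n
  defines "dj \<equiv> \<lambda>k. (fdiff ^^ j) (poly (P k)) \<alpha>"
  defines "K \<equiv> \<Sum>k<n. dj k * dj k / norm_sq F P k"
  assumes ip: "poly_inner_product (inner_prod F)" and "lam > 0"
    and P: "monic_orthogonal (inner_prod F) P"
    and S: "monic_orthogonal (sobolev_prod F j \<alpha> lam) S"
  shows "S n = P n - smult (lam * (dj n / (1 + lam * K))) (\<Sum>k<n. smult (dj k / norm_sq F P k) (P k))"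
proof -
  interpret I: poly_inner_product "inner_prod F" by fact
  interpret J: poly_inner_product "sobolev_prod F j \<alpha> lam"
    using ip \<open>lam > 0\<close> by (intro sobolev_poly_inner_product) auto
  note Pc = monic_orthogonal_coeff[OF P] and Sc = monic_orthogonal_coeff[OF S]
  have h: "norm_sq F P k > 0" for k unfolding norm_sq_def by (rule I.norm_pos[OF P])
  have "K \<ge> 0" unfolding K_def using h by (intro sum_nonneg divide_nonneg_pos) auto
  hence K: "1 + lam * K \<noteq> 0" using \<open>lam > 0\<close> by (smt (verit) mult_nonneg_nonneg)
  define om where "om = dj n / (1 + lam * K)"
  define U where "U = (\<Sum>k<n. smult (dj k / norm_sq F P k) (P k))"
  define T where "T = P n - smult (lam * om) U"
  have Uc: "coeff U i = 0" if "i \<ge> n" for i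
    using that Pc(2) by (simp add: U_def coeff_sum)
  have djT: "(fdiff ^^ j) (poly T) \<alpha> = om"
  proof -
    have "(fdiff ^^ j) (poly U) \<alpha> = K"
      by (simp add: U_def fdiff_iter_poly_sum_smult K_def dj_def)
    hence "(fdiff ^^ j) (poly T) \<alpha> = dj n - lam * om * K"
      by (simp add: T_def fdiff_iter_poly_diff fdiff_iter_poly_smult dj_def del: poly_smult poly_diff)
    also have "dj n = om * (1 + lam * K)" using K by (simp add: om_def)
    finally show ?thesis by (simp add: algebra_simps)
  qed
  have orth: "sobolev_prod F j \<alpha> lam T (P m) = 0" if "m < n" for m
  proof -
    have "inner_prod F U (P m) = (\<Sum>k<n. dj k / norm_sq F P k * inner_prod F (P k) (P m))"
      by (simp add: U_def I.sum_smult_left)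
    also have "\<dots> = (\<Sum>k<n. if k = m then dj m else 0)"
      using h[of m] by (intro sum.cong) (auto simp: I.orthogonal[OF P] norm_sq_def)
    also have "\<dots> = dj m" using that by (simp add: sum.delta)
    finally have "inner_prod F T (P m) = - (lam * om * dj m)"
      using that by (simp add: T_def I.diff_left I.smult_left I.orthogonal[OF P])
    thus ?thesis by (simp add: sobolev_prod_def djT dj_def)
  qed
  have "T = S n"
  proof (rule J.monic_orthogonal_unique[OF S])
    show "coeff T n = 1" using Pc Uc by (simp add: T_def)
    show "coeff T i = 0" if "i > n" for i using Pc Uc that by (simp add: T_def)
    show "sobolev_prod F j \<alpha> lam T (S m) = 0" if "m < n" for m
    proof -
      have "\<exists>c. S m = (\<Sum>k<Suc m. smult (c k) (P k))"
        using Sc(2) by (intro monic_sequence_span[OF monic_orthogonal_monic[OF P]]) auto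
      then obtain c where c: "S m = (\<Sum>k<Suc m. smult (c k) (P k))" by blast
      have "sobolev_prod F j \<alpha> lam T (S m) = (\<Sum>k<Suc m. c k * sobolev_prod F j \<alpha> lam (P k) T)"
        unfolding J.commute[of T "S m"] by (subst c) (rule J.sum_smult_left)
      also have "\<dots> = 0"
        using that orth by (intro sum.neutral) (auto simp: J.commute[of "P _" T])
      finally show ?thesis .
    qed
  qed
  thus ?thesis by (simp add: T_def U_def om_def)
qed

section \<open>The Charlier and Meixner inner products\<close>

lemma weight_Charlier: "weight (Charlier \<mu>) x = exp (- \<mu>) * \<mu> ^ x / fact x"
  using Gamma_fact[of x, where 'a = real] by (simp add: add.commute)

lemma weight_Meixner:
  assumes "\<gamma> > 0"
  shows "weight (Meixner \<gamma> \<mu>) x = \<mu> ^ x * pochhammer \<gamma> x / fact x"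
proof -
  have "\<gamma> \<notin> \<int>\<^sub>\<le>\<^sub>0" using assms by (auto elim: nonpos_Ints_cases)
  thus ?thesis
    using Gamma_fact[of x, where 'a = real] by (simp add: pochhammer_Gamma add.commute)
qed

lemma mu_pos: "admissible F \<Longrightarrow> mu F > 0"
  by (cases F) auto

lemma weight_pos: "admissible F \<Longrightarrow> weight F x > 0"
  by (cases F) (auto simp: weight_Charlier weight_Meixner pochhammer_pos simp del: weight.simps
                intro!: divide_pos_pos mult_pos_pos)

lemma sum_power_over_fact_le_exp:
  assumes "(x::real) \<ge> 0"
  shows "(\<Sum>i\<le>n. x ^ i / fact i) \<le> exp x"
proof -
  have "(\<lambda>i. x ^ i / fact i) sums exp x"
    using exp_converges[of x] by (simp add: field_simps)
  thus ?thesis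
    using sum_le_suminf[of "\<lambda>i. x ^ i / fact i" "{..n}"] assms by (simp add: sums_iff)
qed

text \<open>
  Both weights decay geometrically up to polynomial factors, so all moments converge. For Charlier
  the ratio \<open>1 / 2\<close> is an arbitrary choice: \<open>(2 * \<mu>) ^ x / fact x\<close> is bounded by \<open>exp (2 * \<mu>)\<close>.
\<close>

lemma weight_moderate_geometric:
  assumes "admissible F"
  shows "\<exists>g r. moderate g \<and> 0 < r \<and> r < 1 \<and> (\<forall>x. weight F x = g x * r ^ x)"
proof (cases F)
  case (Charlier \<mu>)
  have "moderate (\<lambda>x. exp (- \<mu>) * ((2 * \<mu>) ^ x / fact x))"
  proof (rule moderateI[of _ "exp (- \<mu>) * exp (2 * \<mu>)" 0])
    fix x
    have "(2 * \<mu>) ^ x / fact x \<le> (\<Sum>i\<le>x. (2 * \<mu>) ^ i / fact i)"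
      using assms Charlier by (intro member_le_sum) auto
    also have "\<dots> \<le> exp (2 * \<mu>)"
      using assms Charlier by (intro sum_power_over_fact_le_exp) auto
    finally have "(2 * \<mu>) ^ x / fact x \<le> exp (2 * \<mu>)" .
    hence "exp (- \<mu>) * ((2 * \<mu>) ^ x / fact x) \<le> exp (- \<mu>) * exp (2 * \<mu>)"
      by (rule mult_left_mono) simp
    hence "exp (- \<mu>) * ((2 * \<mu>) ^ x / fact x) \<le> exp (- \<mu>) * exp (2 * \<mu>) * (real x + 1) ^ 0"
      by (simp only: power_0 mult_1_right)
    moreover have "exp (- \<mu>) * ((2 * \<mu>) ^ x / fact x) \<ge> 0" using assms Charlier by simp
    ultimately show "norm (exp (- \<mu>) * ((2 * \<mu>) ^ x / fact x)) \<le> exp (- \<mu>) * exp (2 * \<mu>) * (real x + 1) ^ 0"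
      unfolding real_norm_def by (simp only: abs_of_nonneg)
  qed
  moreover have "weight F x = exp (- \<mu>) * ((2 * \<mu>) ^ x / fact x) * (1 / 2) ^ x" for x
    unfolding Charlier weight_Charlier by (simp add: power_mult_distrib power_one_over)
  ultimately show ?thesis by (intro exI[of _ "\<lambda>x. exp (- \<mu>) * ((2 * \<mu>) ^ x / fact x)"] exI[of _ "1 / 2"]) auto
next
  case (Meixner \<gamma> \<mu>)
  obtain N where N: "\<gamma> \<le> real N" using real_arch_simple by blast
  have "moderate (\<lambda>x. pochhammer \<gamma> x / fact x)"
  proof (rule moderateI[of _ 1 N])
    show "norm (pochhammer \<gamma> x / fact x) \<le> 1 * (real x + 1) ^ N" for x
      using pochhammer_over_fact_le[of \<gamma> N x] N assms Meixner by (simp add: pochhammer_nonneg)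
  qed
  moreover have "weight F x = pochhammer \<gamma> x / fact x * \<mu> ^ x" for x
    using assms Meixner by (simp add: weight_Meixner del: weight.simps)
  ultimately show ?thesis using assms Meixner
    by (intro exI[of _ "\<lambda>x. pochhammer \<gamma> x / fact x"] exI[of _ \<mu>]) (simp del: weight.simps)
qed

lemma summable_poly_weight:
  assumes "admissible F"
  shows "summable (\<lambda>x. poly p (real x) * weight F x)"
proof -
  obtain g r where g: "moderate g" "0 < r" "r < 1" and w: "\<And>x. weight F x = g x * r ^ x"
    using weight_moderate_geometric[OF assms] by blast
  have "summable (\<lambda>x. (poly p (real x) * g x) * r ^ x)"
    using g by (intro summable_moderate_power moderate_mult moderate_poly) auto
  thus ?thesis by (simp add: w mult.assoc)
qed

lemma inner_prod_sums:
  assumes "admissible F"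
  shows "(\<lambda>x. poly f (real x) * poly g (real x) * weight F x) sums inner_prod F f g"
  using summable_poly_weight[OF assms, of "f * g"]
  by (simp add: inner_prod_def summable_sums)

lemma classical_poly_inner_product:
  assumes "admissible F"
  shows "poly_inner_product (inner_prod F)"
proof
  fix p q r :: "real poly" and c
  note sums = inner_prod_sums[OF assms]
  show "inner_prod F (p + q) r = inner_prod F p r + inner_prod F q r"
    using sums_unique2[OF sums[of "p + q" r]] sums_add[OF sums[of p r] sums[of q r]]
    by (simp add: algebra_simps)
  show "inner_prod F (smult c p) r = c * inner_prod F p r"
    using sums_unique2[OF sums[of "smult c p" r]] sums_mult[OF sums[of p r], of c]
    by (simp add: mult.assoc)
  show "inner_prod F p q = inner_prod F q p"
    by (simp add: inner_prod_def mult.commute)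
  assume "p \<noteq> 0"
  hence "finite {x. poly p x = 0}" by (rule poly_roots_finite)
  hence "finite (real -` {x. poly p x = 0})" by (rule finite_vimageI) (rule inj_of_nat)
  hence "\<exists>x::nat. x \<notin> real -` {x. poly p x = 0}"
    by (rule ex_new_if_finite[OF infinite_UNIV_nat])
  then obtain x :: nat where x: "poly p (real x) \<noteq> 0" by auto
  show "inner_prod F p p > 0" unfolding inner_prod_def
  proof (rule suminf_pos2[of _ x])
    show "summable (\<lambda>x. poly p (real x) * poly p (real x) * weight F x)"
      using sums by (rule sums_summable)
    show "0 \<le> poly p (real n) * poly p (real n) * weight F n" for n
      using weight_pos[OF assms, of n] by (intro mult_nonneg_nonneg zero_le_square) auto
    show "0 < poly p (real x) * poly p (real x) * weight F x"
      using weight_pos[OF assms, of x] x by (metis mult_pos_pos not_real_square_gt_zero)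
  qed
qed

lemma inner_prod_mult_X: "inner_prod F (pCons 0 p) q = inner_prod F p (pCons 0 q)"
  by (simp add: inner_prod_def algebra_simps)

section \<open>Explicit form of the classical polynomials\<close>

text \<open>
  The coefficients of the hypergeometric representation
  \<open>psi n / n! * P n(x) = (\<Sum>k\<le>n. basis_coeff n k * (-x)\<^sub>k / k!)\<close>, where \<open>(-x)\<^sub>k\<close> is the rising
  factorial. Multiplying by \<open>t ^ n\<close> and summing over \<open>n\<close> yields \<open>exp t * (1 - t / \<mu>) powr x\<close> for
  Charlier and \<open>(1 - t / \<mu>) powr x * (1 - t) powr (- x - \<gamma>)\<close> for Meixner. All coefficients with \<open>k \<le> n\<close>
  are positive.
\<close>

fun basis_coeff :: "family \<Rightarrow> nat \<Rightarrow> nat \<Rightarrow> real" where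
  "basis_coeff (Charlier \<mu>) n k = (1 / \<mu>) ^ k / fact (n - k)"
| "basis_coeff (Meixner \<gamma> \<mu>) n k =
     pochhammer \<gamma> n / fact n * real (n choose k) * (fact k / pochhammer \<gamma> k) * (1 / \<mu> - 1) ^ k"

definition explicit_poly :: "family \<Rightarrow> nat \<Rightarrow> real poly" where
  "explicit_poly F n =
     (\<Sum>k\<le>n. smult ((-1) ^ k * basis_coeff F n k / fact k) (falling [:0, 1:] k))"

lemma monic_prod_linear:
  fixes c :: "nat \<Rightarrow> 'a::idom"
  shows "degree (\<Prod>i<k. [:c i, 1:]) = k \<and> lead_coeff (\<Prod>i<k. [:c i, 1:]) = 1"
proof
  show "degree (\<Prod>i<k. [:c i, 1:]) = k" by (simp add: degree_prod_eq_sum_degree)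
  show "lead_coeff (\<Prod>i<k. [:c i, 1:]) = 1" by (subst lead_coeff_prod) simp
qed

lemma falling_poly_monic:
  "degree (falling [:0, 1:: 'a::idom:] k) = k \<and> lead_coeff (falling [:0, 1::'a:] k) = 1"
proof -
  have "falling [:0, 1:: 'a:] k = (\<Prod>i<k. [:- of_nat i, 1:])"
    by (simp add: falling_def of_nat_poly)
  thus ?thesis using monic_prod_linear[of "\<lambda>i. - of_nat i :: 'a" k] by metis
qed

lemma pochhammer_poly_monic:
  "degree (pochhammer [:c, 1:: 'a::idom:] k) = k \<and> lead_coeff (pochhammer [:c, 1:] k) = 1"
proof -
  have "pochhammer [:c, 1:] k = (\<Prod>i<k. [:c + of_nat i, 1:])"
    by (simp add: pochhammer_prod of_nat_poly atLeast0LessThan)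
  thus ?thesis using monic_prod_linear[of "\<lambda>i. c + of_nat i" k] by metis
qed

lemma poly_falling: "poly (falling p k) x = falling (poly p x) k"
  by (simp add: falling_def poly_prod)

lemma poly_pochhammer: "poly (pochhammer p k) x = pochhammer (poly p x) k"
  by (simp add: pochhammer_prod poly_prod)

lemma falling_of_nat_eq_0: "x < k \<Longrightarrow> falling (of_nat x) k = 0"
  unfolding falling_def by (rule prod_zero) auto

lemma falling_of_nat_add: "falling (real (x + k)) k = fact (x + k) / fact x"
proof (induction k arbitrary: x)
  case (Suc k)
  have "falling (real (x + Suc k)) (Suc k) = falling (real (Suc x + k)) k * (real x + 1)"
    by (simp add: falling_Suc)
  also have "\<dots> = fact (x + Suc k) / fact (Suc x) * (real x + 1)"
    by (subst Suc.IH) simp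
  also have "fact (Suc x) = fact x * (real x + 1)" by simp
  also have "fact (x + Suc k) / \<dots> * (real x + 1) = fact (x + Suc k) / fact x"
    by (simp del: fact_Suc add_Suc_right)
  finally show ?case .
qed (simp add: falling_def)

text \<open>
  The factor \<open>falling x k\<close> kills the terms \<open>x < k\<close> and turns \<open>1 / x!\<close> into \<open>1 / (x - k)!\<close>; shifting
  the summation index by \<open>k\<close> moves the product onto the translate of \<open>f\<close>.
\<close>

lemma inner_prod_falling_sums:
  assumes "admissible F"
  shows "(\<lambda>x. poly f (real x + real k) * (fact (x + k) / fact x * weight F (x + k)))
           sums inner_prod F (falling [:0, 1:] k) f"
proof -
  let ?g = "\<lambda>x. poly (falling [:0, 1:] k) (real x) * poly f (real x) * weight F x"
  have "?g sums inner_prod F (falling [:0, 1:] k) f" by (rule inner_prod_sums[OF assms])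
  hence "(\<lambda>x. ?g (x + k)) sums (inner_prod F (falling [:0, 1:] k) f - (\<Sum>x<k. ?g x))"
    by (rule sums_split_initial_segment)
  moreover have "(\<Sum>x<k. ?g x) = 0"
    by (intro sum.neutral) (auto simp: poly_falling falling_of_nat_eq_0)
  moreover have "?g (x + k) = poly f (real x + real k) * (fact (x + k) / fact x * weight F (x + k))" for x
    using falling_of_nat_add[of x k] by (simp add: poly_falling)
  ultimately show ?thesis by simp
qed

lemma inner_prod_explicit_poly:
  assumes "admissible F"
  shows "inner_prod F (explicit_poly F n) f =
    (\<Sum>k\<le>n. (-1) ^ k * basis_coeff F n k / fact k * inner_prod F (falling [:0, 1:] k) f)"
proof -
  interpret poly_inner_product "inner_prod F" by (rule classical_poly_inner_product[OF assms])
  show ?thesis by (simp add: explicit_poly_def sum_smult_left)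
qed

text \<open>
  Here \<open>fact (x + k) / fact x * weight (x + k) = \<mu> ^ k * weight x\<close>, so after the index shift the
  coefficients assemble, for each \<open>x\<close> separately, into an alternating binomial sum of \<open>f\<close>.
\<close>

lemma inner_prod_explicit_Charlier:
  assumes "\<mu> > 0" "degree f < n"
  shows "inner_prod (Charlier \<mu>) (explicit_poly (Charlier \<mu>) n) f = 0"
proof -
  let ?F = "Charlier \<mu>"
  have adm: "admissible ?F" using assms by simp
  have "(\<lambda>x. \<Sum>k\<le>n. (-1) ^ k * basis_coeff ?F n k / fact k *
            (poly f (real x + real k) * (fact (x + k) / fact x * weight ?F (x + k))))
        sums inner_prod ?F (explicit_poly ?F n) f"
    unfolding inner_prod_explicit_poly[OF adm]
    by (intro sums_sum sums_mult inner_prod_falling_sums[OF adm])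
  moreover have "(\<Sum>k\<le>n. (-1) ^ k * basis_coeff ?F n k / fact k *
            (poly f (real x + real k) * (fact (x + k) / fact x * weight ?F (x + k)))) = 0" for x
  proof -
    have "(-1) ^ k * basis_coeff ?F n k / fact k *
            (poly f (real x + real k) * (fact (x + k) / fact x * weight ?F (x + k)))
        = weight ?F x / fact n * ((-1) ^ k * real (n choose k) * poly f (real x + real k))"
      if "k \<le> n" for k
    proof -
      have "real (n choose k) = fact n / (fact k * fact (n - k))"
        using that by (rule binomial_fact)
      thus ?thesis using assms unfolding weight_Charlier basis_coeff.simps
        by (simp add: power_add power_one_over mult_ac)
    qed
    hence "(\<Sum>k\<le>n. (-1) ^ k * basis_coeff ?F n k / fact k *
            (poly f (real x + real k) * (fact (x + k) / fact x * weight ?F (x + k))))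
        = weight ?F x / fact n * (\<Sum>k\<le>n. (-1) ^ k * real (n choose k) * poly f (real x + real k))"
      unfolding sum_distrib_left by (intro sum.cong) auto
    thus ?thesis using alternating_binomial_sum_poly_eq_0[OF assms(2)] by simp
  qed
  ultimately have "(\<lambda>x. 0) sums inner_prod ?F (explicit_poly ?F n) f" by (simp only:)
  thus ?thesis using sums_unique2 sums_zero by blast
qed

lemma pochhammer_binomial_sums:
  assumes "\<bar>\<mu>\<bar> < (1::real)"
  shows "(\<lambda>x. pochhammer a x / fact x * \<mu> ^ x) sums (1 - \<mu>) powr (- a)"
proof -
  have "((- a) gchoose x) * (- \<mu>) ^ x = pochhammer a x / fact x * \<mu> ^ x" for x
    by (simp add: gbinomial_pochhammer power_minus[of \<mu>])
  thus ?thesis using gen_binomial_real[of "- \<mu>" "- a"] assms by simp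
qed

text \<open>
  The test polynomials \<open>pochhammer (\<gamma> + x) m\<close> fit the weight: after the index shift the two rising
  factorials merge into \<open>pochhammer \<gamma> (k + m) * pochhammer (\<gamma> + k + m) x\<close>, and the binomial series sums
  over \<open>x\<close> in closed form. With the coefficients multiplied in, the powers of \<open>\<mu>\<close> and \<open>1 - \<mu>\<close>
  with exponent \<open>k\<close> cancel, and what remains depends on \<open>k\<close> only through \<open>(-1) ^ k * (n choose k)\<close> and
  \<open>pochhammer (\<gamma> + k) m\<close>, a polynomial in \<open>k\<close> of degree \<open>m < n\<close>.
\<close>

lemma inner_prod_explicit_Meixner:
  assumes "\<gamma> > 0" "0 < \<mu>" "\<mu> < 1" "m < n"
  shows "inner_prod (Meixner \<gamma> \<mu>) (explicit_poly (Meixner \<gamma> \<mu>) n) (pochhammer [:\<gamma>, 1:] m) = 0"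
proof -
  let ?F = "Meixner \<gamma> \<mu>" and ?q = "pochhammer [:\<gamma>, 1:] m"
  have adm: "admissible ?F" using assms by simp
  have inner: "inner_prod ?F (falling [:0, 1:] k) ?q
      = \<mu> ^ k * pochhammer \<gamma> (k + m) * (1 - \<mu>) powr (- (\<gamma> + real (k + m)))" for k
  proof -
    have "poly ?q (real x + real k) * (fact (x + k) / fact x * weight ?F (x + k))
        = \<mu> ^ k * pochhammer \<gamma> (k + m) * (pochhammer (\<gamma> + real (k + m)) x / fact x * \<mu> ^ x)" for x
    proof -
      have "pochhammer \<gamma> (x + k) * pochhammer (\<gamma> + real (x + k)) m = pochhammer \<gamma> (x + k + m)"
        by (simp add: pochhammer_product')
      also have "x + k + m = k + m + x" by simp
      also have "pochhammer \<gamma> (k + m + x) = pochhammer \<gamma> (k + m) * pochhammer (\<gamma> + real (k + m)) x"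
        by (rule pochhammer_product')
      finally have "pochhammer \<gamma> (x + k) * pochhammer (\<gamma> + (real x + real k)) m
          = pochhammer \<gamma> (k + m) * pochhammer (\<gamma> + real (k + m)) x" by simp
      thus ?thesis
        unfolding weight_Meixner[OF assms(1)] poly_pochhammer
        by (simp add: power_add field_simps)
    qed
    hence "(\<lambda>x. \<mu> ^ k * pochhammer \<gamma> (k + m) * (pochhammer (\<gamma> + real (k + m)) x / fact x * \<mu> ^ x))
        sums inner_prod ?F (falling [:0, 1:] k) ?q"
      using inner_prod_falling_sums[OF adm, of ?q k] by (simp only:)
    moreover have "(\<lambda>x. \<mu> ^ k * pochhammer \<gamma> (k + m) * (pochhammer (\<gamma> + real (k + m)) x / fact x * \<mu> ^ x))
        sums (\<mu> ^ k * pochhammer \<gamma> (k + m) * (1 - \<mu>) powr (- (\<gamma> + real (k + m))))"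
      using assms by (intro sums_mult pochhammer_binomial_sums) auto
    ultimately show ?thesis by (rule sums_unique2)
  qed
  have "(-1) ^ k * basis_coeff ?F n k / fact k * inner_prod ?F (falling [:0, 1:] k) ?q
      = pochhammer \<gamma> n / fact n * (1 - \<mu>) powr (- (\<gamma> + real m)) *
        ((-1) ^ k * real (n choose k) * poly ?q (0 + real k))" for k
  proof -
    have "(1 - \<mu>) powr (- (\<gamma> + real m)) = (1 - \<mu>) powr (- (\<gamma> + real (k + m)) + real k)"
      by (rule arg_cong[where f = "(powr) (1 - \<mu>)"]) simp
    also have "\<dots> = (1 - \<mu>) powr (- (\<gamma> + real (k + m))) * (1 - \<mu>) ^ k"
      using assms by (simp only: powr_add powr_realpow)
    finally have 1: "(1 - \<mu>) powr (- (\<gamma> + real m)) = (1 - \<mu>) powr (- (\<gamma> + real (k + m))) * (1 - \<mu>) ^ k" .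
    \<comment> \<open>So the powers from \<open>basis_coeff\<close> and from the index shift cancel against the binomial series.\<close>
    have 2: "(1 - \<mu>) ^ k = (1 / \<mu> - 1) ^ k * \<mu> ^ k"
      using assms by (simp add: power_mult_distrib[symmetric] field_simps)
    have 3: "pochhammer \<gamma> (k + m) = pochhammer \<gamma> k * poly ?q (0 + real k)"
      by (simp add: pochhammer_product' poly_pochhammer)
    have "pochhammer \<gamma> k \<noteq> 0" using pochhammer_pos[OF assms(1), of k] by simp
    thus ?thesis
      unfolding inner 1 2 3 basis_coeff.simps by simp
  qed
  hence "inner_prod ?F (explicit_poly ?F n) ?q
      = pochhammer \<gamma> n / fact n * (1 - \<mu>) powr (- (\<gamma> + real m)) *
        (\<Sum>k\<le>n. (-1) ^ k * real (n choose k) * poly ?q (0 + real k))"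
    by (simp only: inner_prod_explicit_poly[OF adm] sum_distrib_left)
  also have "degree ?q < n" using pochhammer_poly_monic[of \<gamma> m] assms by simp
  hence "(\<Sum>k\<le>n. (-1) ^ k * real (n choose k) * poly ?q (0 + real k)) = 0"
    by (rule alternating_binomial_sum_poly_eq_0)
  finally show ?thesis by simp
qed

lemma inner_prod_explicit_poly_eq_0:
  assumes "admissible F" "degree f < n"
  shows "inner_prod F (explicit_poly F n) f = 0"
proof (cases F)
  case (Charlier \<mu>)
  thus ?thesis using assms inner_prod_explicit_Charlier by simp
next
  case (Meixner \<gamma> \<mu>)
  interpret poly_inner_product "inner_prod F" by (rule classical_poly_inner_product[OF assms(1)])
  have "\<exists>c. f = (\<Sum>m<n. smult (c m) (pochhammer [:\<gamma>, 1:] m))"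
    using pochhammer_poly_monic assms(2) by (intro monic_sequence_span) (auto intro: coeff_eq_0)
  then obtain c where c: "f = (\<Sum>m<n. smult (c m) (pochhammer [:\<gamma>, 1:] m))" by blast
  have "inner_prod F f (explicit_poly F n)
      = (\<Sum>m<n. c m * inner_prod F (pochhammer [:\<gamma>, 1:] m) (explicit_poly F n))"
    by (subst c) (rule sum_smult_left)
  also have "\<dots> = 0"
  proof (intro sum.neutral ballI)
    fix m assume "m \<in> {..<n}"
    hence "inner_prod F (explicit_poly F n) (pochhammer [:\<gamma>, 1:] m) = 0"
      using assms Meixner inner_prod_explicit_Meixner[of \<gamma> \<mu> m n] by simp
    thus "c m * inner_prod F (pochhammer [:\<gamma>, 1:] m) (explicit_poly F n) = 0"
      by (simp add: commute)
  qed
  finally show ?thesis by (simp add: commute)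
qed

lemma psi_eq_basis_coeff:
  assumes "admissible F"
  shows "psi F n = (-1) ^ n * basis_coeff F n n"
proof (cases F)
  case (Charlier \<mu>)
  have "psi F n = (inverse (- \<mu>)) ^ n" using Charlier by (simp add: power_int_minus flip: power_inverse)
  also have "inverse (- \<mu>) = (-1) * (1 / \<mu>)" by (simp add: inverse_eq_divide)
  also have "\<dots> ^ n = (-1) ^ n * (1 / \<mu>) ^ n" by (rule power_mult_distrib)
  finally show ?thesis using Charlier by simp
next
  case (Meixner \<gamma> \<mu>)
  have "pochhammer \<gamma> n > 0" using Meixner assms by (intro pochhammer_pos) simp
  moreover have "(\<mu> - 1) ^ n / \<mu> ^ n = (-1) ^ n * (1 / \<mu> - 1) ^ n"
    using Meixner assms by (simp add: field_simps flip: power_mult_distrib power_divide)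
  ultimately show ?thesis using Meixner by (simp add: power_int_minus field_simps)
qed

lemma basis_coeff_pos:
  assumes "admissible F" "k \<le> n"
  shows "basis_coeff F n k > 0"
  using assms by (cases F) (auto intro!: mult_pos_pos divide_pos_pos pochhammer_pos zero_less_power simp: field_simps)

lemma psi_nonzero: "admissible F \<Longrightarrow> psi F n \<noteq> 0"
  using basis_coeff_pos[of F n n] by (simp add: psi_eq_basis_coeff)

lemma classical_eq_explicit:
  assumes F: "admissible F" and P: "monic_orthogonal (inner_prod F) P"
  shows "smult (psi F n / fact n) (P n) = explicit_poly F n"
proof -
  interpret poly_inner_product "inner_prod F" by (rule classical_poly_inner_product[OF F])
  note nz = psi_nonzero[OF F, of n]
  have c: "coeff (falling [:0, 1::real:] k) i = (if i = k then 1 else 0)" if "i \<ge> k" for i k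
    using falling_poly_monic[of k, where 'a = real] that coeff_eq_0[of "falling [:0, 1::real:] k" i]
    by (cases "i = k") (metis, simp)
  have "smult (fact n / psi F n) (explicit_poly F n) = P n"
  proof (rule monic_orthogonal_unique[OF P])
    have "coeff (explicit_poly F n) n
        = (\<Sum>k\<le>n. if n = k then (-1) ^ k * basis_coeff F n k / fact k else 0)"
      by (simp add: explicit_poly_def coeff_sum c if_distrib cong: if_cong)
    also have "\<dots> = psi F n / fact n"
      by (simp add: psi_eq_basis_coeff[OF F])
    finally show "coeff (smult (fact n / psi F n) (explicit_poly F n)) n = 1" using nz by simp
    show "coeff (smult (fact n / psi F n) (explicit_poly F n)) i = 0" if "i > n" for i
      using that by (simp add: explicit_poly_def coeff_sum c)
    show "inner_prod F (smult (fact n / psi F n) (explicit_poly F n)) (P m) = 0" if "m < n" for m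
      using that monic_orthogonal_monic[OF P, of m] F
      by (simp add: smult_left inner_prod_explicit_poly_eq_0)
  qed
  hence "smult (psi F n / fact n) (smult (fact n / psi F n) (explicit_poly F n))
      = smult (psi F n / fact n) (P n)" by (rule arg_cong)
  thus ?thesis using nz by simp
qed

section \<open>Growth of the classical polynomials\<close>

text \<open>
  For Charlier the sum is a partial sum of the exponential series. For Meixner both Pochhammer
  quotients are of moderate growth, and what is left is the binomial expansion of
  \<open>(1 + (1 / \<mu> - 1)) ^ n = (1 / \<mu>) ^ n\<close>.
\<close>

lemma moderate_sum_basis_coeff:
  assumes "admissible F"
  shows "moderate (\<lambda>n. mu F ^ n * (\<Sum>k\<le>n. basis_coeff F n k))"
proof (cases F)
  case (Charlier \<mu>)
  have \<mu>: "\<mu> > 0" using assms Charlier by simp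
  have "mu F ^ n * (\<Sum>k\<le>n. basis_coeff F n k) = (\<Sum>i\<le>n. \<mu> ^ i / fact i)" for n
  proof -
    have "mu F ^ n * (\<Sum>k\<le>n. basis_coeff F n k) = (\<Sum>k\<le>n. \<mu> ^ (n - k) / fact (n - k))"
      unfolding sum_distrib_left using \<mu>
      by (intro sum.cong) (simp_all add: Charlier power_diff power_one_over)
    also have "\<dots> = (\<Sum>i\<le>n. \<mu> ^ i / fact i)"
      using sum.atLeastAtMost_rev[of "\<lambda>i. \<mu> ^ i / fact i" 0 n] by (simp add: atMost_atLeast0)
    finally show ?thesis .
  qed
  moreover have "norm (\<Sum>i\<le>n. \<mu> ^ i / fact i) \<le> exp \<mu> * (real n + 1) ^ 0" for n
  proof -
    have "(\<Sum>i\<le>n. \<mu> ^ i / fact i) \<ge> 0" using \<mu> by (intro sum_nonneg) auto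
    thus ?thesis using sum_power_over_fact_le_exp[of \<mu> n] \<mu> by simp
  qed
  ultimately show ?thesis by (simp add: moderateI[of _ "exp \<mu>" 0])
next
  case (Meixner \<gamma> \<mu>)
  have \<mu>: "\<gamma> > 0" "\<mu> > 0" "\<mu> < 1" using assms Meixner by auto
  obtain N where N: "\<gamma> \<le> real N" using real_arch_simple by blast
  define m where "m = min 1 \<gamma>"
  have m: "m > 0" using \<mu> by (simp add: m_def)
  have "norm (mu F ^ n * (\<Sum>k\<le>n. basis_coeff F n k)) \<le> (1 / m) * (real n + 1) ^ (N + 1)" for n
  proof -
    let ?D = "(real n + 1) ^ N * ((real n + 1) / m)"
    have le: "basis_coeff F n k \<le> ?D * (real (n choose k) * (1 / \<mu> - 1) ^ k * 1 ^ (n - k))" if "k \<le> n" for k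
    proof -
      have "m / (real n + 1) \<le> m / (real k + 1)" using that m by (intro divide_left_mono) auto
      also have "\<dots> \<le> pochhammer \<gamma> k / fact k"
        using pochhammer_over_fact_ge[of \<gamma> k] \<mu> by (simp add: m_def)
      finally have "inverse (pochhammer \<gamma> k / fact k) \<le> inverse (m / (real n + 1))"
        using m by (intro le_imp_inverse_le) auto
      hence "fact k / pochhammer \<gamma> k \<le> (real n + 1) / m" by simp
      hence "pochhammer \<gamma> n / fact n * (fact k / pochhammer \<gamma> k) \<le> ?D"
        using pochhammer_over_fact_le[of \<gamma> N n] N \<mu> 
        by (intro mult_mono) (auto intro!: divide_nonneg_nonneg pochhammer_nonneg)
      hence "pochhammer \<gamma> n / fact n * (fact k / pochhammer \<gamma> k) * (real (n choose k) * (1 / \<mu> - 1) ^ k)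
          \<le> ?D * (real (n choose k) * (1 / \<mu> - 1) ^ k)"
        using \<mu> by (intro mult_right_mono mult_nonneg_nonneg zero_le_power) auto
      thus ?thesis by (simp add: Meixner mult_ac)
    qed
    have "(\<Sum>k\<le>n. basis_coeff F n k) \<le> (\<Sum>k\<le>n. ?D * (real (n choose k) * (1 / \<mu> - 1) ^ k * 1 ^ (n - k)))"
      by (intro sum_mono le) auto
    also have "\<dots> = ?D * (1 / \<mu>) ^ n"
      unfolding sum_distrib_left[symmetric] binomial_ring[symmetric] by simp
    finally have "\<mu> ^ n * (\<Sum>k\<le>n. basis_coeff F n k) \<le> \<mu> ^ n * (?D * (1 / \<mu>) ^ n)"
      using \<mu> by (intro mult_left_mono) auto
    also have "\<dots> = (1 / m) * (real n + 1) ^ (N + 1)"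
      using \<mu> by (simp add: power_one_over)
    finally have "\<mu> ^ n * (\<Sum>k\<le>n. basis_coeff F n k) \<le> (1 / m) * (real n + 1) ^ (N + 1)" .
    moreover have "\<mu> ^ n * (\<Sum>k\<le>n. basis_coeff F n k) \<ge> 0"
      using \<mu> basis_coeff_pos[OF assms] by (intro mult_nonneg_nonneg sum_nonneg) (auto intro: less_imp_le)
    ultimately show ?thesis by (simp only: Meixner family.sel real_norm_def abs_of_nonneg)
  qed
  thus ?thesis by (rule moderateI)
qed

lemma binomial_diff_diff_le: "j \<le> k \<Longrightarrow> k \<le> n \<Longrightarrow> (n - j) choose (k - j) \<le> n choose k"
proof (induction j arbitrary: n k)
  case (Suc j)
  then obtain n' k' where nk: "n = Suc n'" "k = Suc k'" by (metis Suc_le_D le_trans)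
  have "(n' - j) choose (k' - j) \<le> n' choose k'" using Suc nk by simp
  also have "\<dots> \<le> Suc n' choose Suc k'" by simp
  finally show ?case using nk by simp
qed simp

text \<open>
  The matching lower bound. For Charlier the single term \<open>k = n\<close> suffices. For Meixner
  \<open>n choose k \<ge> (n - j) choose (k - j)\<close> leaves a full binomial expansion of exponent \<open>n - j\<close>, which
  costs only the constant factor \<open>(1 - \<mu>) ^ j\<close>.
\<close>

lemma sum_basis_coeff_lower_bound:
  assumes "admissible F"
  shows "\<exists>C M. C > 0 \<and>
    (\<forall>n\<ge>j. 1 \<le> C * (real n + 1) ^ M * (mu F ^ n * (\<Sum>k=j..n. basis_coeff F n k)))"
proof (cases F)
  case (Charlier \<mu>)
  have \<mu>: "\<mu> > 0" using assms Charlier by simp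
  have "1 \<le> 1 * (real n + 1) ^ 0 * (mu F ^ n * (\<Sum>k=j..n. basis_coeff F n k))" if "n \<ge> j" for n
  proof -
    have "basis_coeff F n n \<le> (\<Sum>k=j..n. basis_coeff F n k)"
      using that basis_coeff_pos[OF assms] by (intro member_le_sum) (auto intro: less_imp_le)
    hence "\<mu> ^ n * basis_coeff F n n \<le> \<mu> ^ n * (\<Sum>k=j..n. basis_coeff F n k)"
      using \<mu> by (intro mult_left_mono) auto
    moreover have "\<mu> ^ n * basis_coeff F n n = 1" using \<mu> by (simp add: Charlier power_one_over)
    ultimately show ?thesis by (simp add: Charlier)
  qed
  thus ?thesis by (intro exI[of _ 1] exI[of _ 0]) auto
next
  case (Meixner \<gamma> \<mu>)
  have \<mu>: "\<gamma> > 0" "\<mu> > 0" "\<mu> < 1" using assms Meixner by auto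
  obtain N where N: "\<gamma> \<le> real N" using real_arch_simple by blast
  define m where "m = min 1 \<gamma>"
  define c where "c = 1 / \<mu> - 1"
  have m: "m > 0" using \<mu> by (simp add: m_def)
  have c: "c > 0" using \<mu> by (simp add: c_def field_simps)
  have c\<mu>: "c * \<mu> = 1 - \<mu>" using \<mu> by (simp add: c_def field_simps)
  have "1 \<le> 1 / (m * (1 - \<mu>) ^ j) * (real n + 1) ^ (N + 1) * (mu F ^ n * (\<Sum>k=j..n. basis_coeff F n k))"
    if n: "n \<ge> j" for n
  proof -
    let ?D = "(m / (real n + 1)) * (1 / (real n + 1) ^ N)"
    have D: "?D > 0" using m by simp
    have ge: "?D * (real ((n - j) choose (k - j)) * c ^ k) \<le> basis_coeff F n k" if k: "k \<in> {j..n}" for k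
    proof -
      have "pochhammer \<gamma> k / fact k \<le> (real k + 1) ^ N"
        using \<mu> N by (intro pochhammer_over_fact_le) auto
      also have "\<dots> \<le> (real n + 1) ^ N" using k by (intro power_mono) auto
      finally have "inverse ((real n + 1) ^ N) \<le> inverse (pochhammer \<gamma> k / fact k)"
        using \<mu> by (intro le_imp_inverse_le divide_pos_pos pochhammer_pos) auto
      hence "1 / (real n + 1) ^ N \<le> fact k / pochhammer \<gamma> k" by (simp add: inverse_eq_divide)
      moreover have "m / (real n + 1) \<le> pochhammer \<gamma> n / fact n"
        using pochhammer_over_fact_ge[of \<gamma> n] \<mu> by (simp add: m_def)
      ultimately have 1: "?D \<le> pochhammer \<gamma> n / fact n * (fact k / pochhammer \<gamma> k)"
        using m \<mu> by (intro mult_mono) (auto intro!: divide_nonneg_nonneg pochhammer_nonneg)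
      have "real ((n - j) choose (k - j)) * c ^ k \<le> real (n choose k) * c ^ k"
        using binomial_diff_diff_le[of j k n] k c by (intro mult_right_mono) auto
      hence "?D * (real ((n - j) choose (k - j)) * c ^ k)
          \<le> (pochhammer \<gamma> n / fact n * (fact k / pochhammer \<gamma> k)) * (real (n choose k) * c ^ k)"
      proof (rule mult_mono[OF 1])
        show "0 \<le> pochhammer \<gamma> n / fact n * (fact k / pochhammer \<gamma> k)"
          by (rule order.trans[OF less_imp_le[OF D] 1])
        show "0 \<le> real ((n - j) choose (k - j)) * c ^ k" using c by simp
      qed
      also have "\<dots> = basis_coeff F n k"
        unfolding Meixner basis_coeff.simps c_def[symmetric] by (simp only: mult_ac)
      finally show ?thesis .
    qed
    have "(1 - \<mu>) ^ j * ?D = \<mu> ^ n * (?D * (c ^ j * (1 / \<mu>) ^ (n - j)))"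
    proof -
      have "(1 - \<mu>) ^ j = c ^ j * \<mu> ^ j" by (simp only: c\<mu>[symmetric] power_mult_distrib)
      also have "\<mu> ^ j = \<mu> ^ n * (1 / \<mu>) ^ (n - j)"
      proof -
        have "\<mu> ^ n = \<mu> ^ j * \<mu> ^ (n - j)" using n by (simp flip: power_add)
        thus ?thesis using \<mu> by (simp add: power_one_over)
      qed
      finally show ?thesis by (simp only: mult_ac)
    qed
    also have "c ^ j * (1 / \<mu>) ^ (n - j) = c ^ j * (\<Sum>i\<le>n - j. real ((n - j) choose i) * c ^ i * 1 ^ (n - j - i))"
      unfolding binomial_ring[symmetric] by (simp add: c_def)
    also have "\<dots> = (\<Sum>k=j..n. real ((n - j) choose (k - j)) * c ^ k)"
      unfolding sum_distrib_left
      by (rule sum.reindex_bij_witness[of _ "\<lambda>k. k - j" "\<lambda>i. i + j"])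
         (use n in \<open>auto simp: power_add\<close>)
    also have "\<mu> ^ n * (?D * \<dots>) \<le> \<mu> ^ n * (\<Sum>k=j..n. basis_coeff F n k)"
      unfolding sum_distrib_left[of ?D] using \<mu> by (intro mult_left_mono sum_mono ge) auto
    finally have "(1 - \<mu>) ^ j * ?D \<le> mu F ^ n * (\<Sum>k=j..n. basis_coeff F n k)"
      by (simp add: Meixner)
    hence "1 / (m * (1 - \<mu>) ^ j) * (real n + 1) ^ (N + 1) * ((1 - \<mu>) ^ j * ?D)
      \<le> 1 / (m * (1 - \<mu>) ^ j) * (real n + 1) ^ (N + 1) * (mu F ^ n * (\<Sum>k=j..n. basis_coeff F n k))"
      using m \<mu> by (intro mult_left_mono) auto
    moreover have "1 / (m * (1 - \<mu>) ^ j) * (real n + 1) ^ (N + 1) * ((1 - \<mu>) ^ j * ?D) = 1"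
    proof -
      have "1 / (m * y) * (z * w) * (y * (m / w * (1 / z))) = 1" if "y \<noteq> 0" "z \<noteq> 0" "w \<noteq> 0" for y z w :: real
        using that m by simp
      from this[of "(1 - \<mu>) ^ j" "(real n + 1) ^ N" "real n + 1"] show ?thesis
        using \<mu> m by (simp only: power_add power_one_right) simp
    qed
    ultimately show ?thesis by (simp only:)
  qed
  moreover have "1 / (m * (1 - \<mu>) ^ j) > 0" using m \<mu> by simp
  ultimately show ?thesis by blast
qed

lemma cpoly_falling: "cpoly (falling [:0, 1:] k) x = falling x k"
proof (induction k)
  case 0
  have "cpoly 1 x = 1" by (simp add: cpoly_def)
  thus ?case by (simp add: falling_def)
qed (simp add: falling_Suc of_nat_poly algebra_simps)

lemma norm_falling_le: "norm (falling x k) \<le> pochhammer (norm (x :: complex)) k"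
proof -
  have "norm (falling x k) = (\<Prod>i<k. norm (x - of_nat i))"
    by (simp add: falling_def prod_norm)
  also have "\<dots> \<le> (\<Prod>i<k. norm x + real i)"
    by (intro prod_mono) (use norm_triangle_ineq4[of x "of_nat _"] in auto)
  finally show ?thesis by (simp add: pochhammer_prod atLeast0LessThan)
qed

lemma pochhammer_minus_falling: "pochhammer (- a) k = (-1) ^ k * falling a k"
  for a :: "'a::comm_ring_1"
proof (induction k)
  case (Suc k)
  thus ?case by (simp add: pochhammer_Suc falling_Suc algebra_simps)
qed (simp add: falling_def)

lemma fdiff_falling: "fdiff (\<lambda>y. falling y (Suc k)) y = of_nat (Suc k) * falling y k"
proof -
  have "falling (y + 1) (Suc k) = (y + 1) * falling y k"
    unfolding falling_def by (subst prod.lessThan_Suc_shift) simp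
  thus ?thesis by (simp add: fdiff_def falling_Suc algebra_simps)
qed

lemma fdiff_iter_falling:
  fixes y :: "'a::field_char_0"
  assumes "j \<le> k"
  shows "(fdiff ^^ j) (\<lambda>y. falling y k) y = fact k / fact (k - j) * falling y (k - j)"
  using assms
proof (induction j arbitrary: y)
  case (Suc j)
  then obtain m where m: "k - j = Suc m" by (metis Suc_diff_Suc Suc_le_lessD)
  have "(fdiff ^^ Suc j) (\<lambda>y. falling y k) y = fact k / fact (k - j) * fdiff (\<lambda>y. falling y (k - j)) y"
    using Suc by (simp add: fdiff_def[of "\<lambda>y. falling y (k - j)"] fdiff_iter_Suc right_diff_distrib
                       del: funpow.simps)
  also have "\<dots> = fact k / (of_nat (Suc m) * fact m) * (of_nat (Suc m) * falling y m)"
    by (simp only: m fdiff_falling fact_Suc)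
  also have "\<dots> = fact k / fact m * falling y m"
    by (simp del: of_nat_Suc)
  also have "m = k - Suc j" using m by simp
  finally show ?case .
qed simp

locale classical_family =
  fixes F :: family and P :: "nat \<Rightarrow> real poly"
  assumes admissible: "admissible F" and P: "monic_orthogonal (inner_prod F) P"
begin

text \<open>
  The normalisation under which \<open>scale n * P n(x)\<close> is the coefficient of \<open>(t / \<mu>) ^ n\<close> in the
  generating function, so that convergence on the disc becomes moderate growth.
\<close>

definition scale :: "nat \<Rightarrow> real" where
  "scale n = psi F n / fact n * mu F ^ n"

lemma scale_nonzero: "scale n \<noteq> 0"
  using psi_nonzero[OF admissible] mu_pos[OF admissible] by (simp add: scale_def)

lemma scale_cpoly:
  "of_real (scale n) * cpoly (P n) x =
     of_real (mu F) ^ n * (\<Sum>k\<le>n. of_real (basis_coeff F n k) * (pochhammer (- x) k / fact k))"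
proof -
  have "of_real (psi F n / fact n) * cpoly (P n) x = cpoly (explicit_poly F n) x"
    by (simp add: classical_eq_explicit[OF admissible P, symmetric])
  also have "\<dots> = (\<Sum>k\<le>n. of_real (basis_coeff F n k) * (pochhammer (- x) k / fact k))"
    by (simp add: explicit_poly_def cpoly_falling pochhammer_minus_falling mult_ac)
  finally have *: "of_real (psi F n / fact n) * cpoly (P n) x
      = (\<Sum>k\<le>n. of_real (basis_coeff F n k) * (pochhammer (- x) k / fact k))" .
  have "of_real (scale n) * cpoly (P n) x
      = of_real (mu F) ^ n * (of_real (psi F n / fact n) * cpoly (P n) x)"
    by (simp add: scale_def)
  thus ?thesis by (simp only: *)
qed

lemma moderate_scaled_cpoly: "moderate (\<lambda>n. of_real (scale n) * cpoly (P n) x)"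
proof -
  obtain N where N: "norm x \<le> real N" using real_arch_simple by blast
  have \<mu>: "mu F > 0" by (rule mu_pos[OF admissible])
  have bound: "norm (of_real (scale n) * cpoly (P n) x)
      \<le> norm ((mu F ^ n * (\<Sum>k\<le>n. basis_coeff F n k)) * (real n + 1) ^ N)" for n
  proof -
    have "norm (\<Sum>k\<le>n. of_real (basis_coeff F n k) * (pochhammer (- x) k / fact k))
        \<le> (\<Sum>k\<le>n. basis_coeff F n k * (real n + 1) ^ N)"
    proof (intro sum_norm_le)
      fix k assume "k \<in> {..n}"
      hence b: "basis_coeff F n k > 0" using basis_coeff_pos[OF admissible] by simp
      have "norm (pochhammer (- x) k / fact k) \<le> pochhammer (norm x) k / fact k"
        using norm_falling_le[of x k]
        by (simp add: pochhammer_minus_falling norm_mult norm_divide norm_power divide_right_mono)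
      also have "\<dots> \<le> (real k + 1) ^ N" using N by (intro pochhammer_over_fact_le) auto
      also have "\<dots> \<le> (real n + 1) ^ N" using \<open>k \<in> {..n}\<close> by (intro power_mono) auto
      finally show "norm (of_real (basis_coeff F n k) * (pochhammer (- x) k / fact k))
          \<le> basis_coeff F n k * (real n + 1) ^ N"
        unfolding norm_mult using b by (intro mult_mono) auto
    qed
    hence "mu F ^ n * norm (\<Sum>k\<le>n. of_real (basis_coeff F n k) * (pochhammer (- x) k / fact k))
      \<le> mu F ^ n * ((\<Sum>k\<le>n. basis_coeff F n k) * (real n + 1) ^ N)"
      using \<mu> by (intro mult_left_mono) (auto simp: sum_distrib_right)
    also have "\<dots> \<le> norm ((mu F ^ n * (\<Sum>k\<le>n. basis_coeff F n k)) * (real n + 1) ^ N)"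
      by (simp add: mult.assoc)
    finally show ?thesis using \<mu> by (simp add: scale_cpoly norm_mult norm_power)
  qed
  show ?thesis
    by (rule moderate_le[OF moderate_mult[OF moderate_sum_basis_coeff[OF admissible] moderate_power_Suc[of N]]])
       (use bound in auto)
qed

definition scaled_diff :: "nat \<Rightarrow> real \<Rightarrow> nat \<Rightarrow> real" where
  "scaled_diff j \<alpha> n = scale n * (fdiff ^^ j) (poly (P n)) \<alpha>"

lemma moderate_scaled_diff: "moderate (scaled_diff j \<alpha>)"
proof -
  have "of_real (scaled_diff j \<alpha> n) = (\<Sum>i\<le>j. ((-1) ^ (j + i) * of_nat (j choose i)) *
      (of_real (scale n) * cpoly (P n) (of_real \<alpha> + of_nat i)))" for n
    unfolding scaled_diff_def of_real_mult fdiff_iter_cpoly_of_real[symmetric] fdiff_iter_eq_sum[of j "cpoly _"]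
    by (simp add: sum_distrib_left mult_ac)
  moreover have "moderate (\<lambda>n. \<Sum>i\<le>j. ((-1) ^ (j + i) * of_nat (j choose i)) *
      (of_real (scale n) * cpoly (P n) (of_real \<alpha> + of_nat i)))"
    by (intro moderate_sum moderate_mult[OF moderate_const] moderate_scaled_cpoly) auto
  ultimately have "moderate (\<lambda>n. of_real (scaled_diff j \<alpha> n) :: complex)" by (simp only:)
  thus ?thesis by (simp only: moderate_of_real_iff)
qed

lemma scaled_diff_eq_0: "n < j \<Longrightarrow> scaled_diff j \<alpha> n = 0"
  using monic_orthogonal_monic[OF P, of n] by (simp add: scaled_diff_def fdiff_iter_poly_eq_0)

text \<open>
  Differences act on the rising factorials \<open>(-x)\<^sub>k\<close> by lowering \<open>k\<close>. For \<open>\<alpha> < 0\<close> every summand on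
  the right is nonnegative, which rules out cancellation.
\<close>

lemma scaled_diff_eq_sum:
  "(-1) ^ j * scaled_diff j \<alpha> n =
     mu F ^ n * (\<Sum>k=j..n. basis_coeff F n k * (pochhammer (- \<alpha>) (k - j) / fact (k - j)))"
proof -
  have fall: "(fdiff ^^ j) (poly (falling [:0, 1:] k)) \<alpha>
      = (if j \<le> k then fact k / fact (k - j) * falling \<alpha> (k - j) else 0)" for k
  proof (cases "j \<le> k")
    case True
    have "poly (falling [:0, 1::real:] k) = (\<lambda>y. falling y k)" by (simp add: fun_eq_iff poly_falling)
    thus ?thesis using True by (simp only: fdiff_iter_falling[OF True] if_True simp_thms)
  next
    case False
    hence "degree (falling [:0, 1::real:] k) < j" using falling_poly_monic[of k, where 'a = real] by linarith
    thus ?thesis using False by (simp only: fdiff_iter_poly_eq_0 if_False)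
  qed
  have "psi F n / fact n * (fdiff ^^ j) (poly (P n)) \<alpha> = (fdiff ^^ j) (poly (explicit_poly F n)) \<alpha>"
    by (simp only: classical_eq_explicit[OF admissible P, symmetric] fdiff_iter_poly_smult)
  also have "\<dots> = (\<Sum>k\<le>n. if j \<le> k then (-1) ^ k * basis_coeff F n k * (falling \<alpha> (k - j) / fact (k - j)) else 0)"
    unfolding explicit_poly_def fdiff_iter_poly_sum_smult fall by (intro sum.cong) auto
  also have "\<dots> = (\<Sum>k=j..n. (-1) ^ k * basis_coeff F n k * (falling \<alpha> (k - j) / fact (k - j)))"
    by (intro sum.mono_neutral_cong_right) auto
  also have "\<dots> = (-1) ^ j * (\<Sum>k=j..n. basis_coeff F n k * (pochhammer (- \<alpha>) (k - j) / fact (k - j)))"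
    unfolding sum_distrib_left
  proof (intro sum.cong refl)
    fix k assume "k \<in> {j..n}"
    hence "(-1 :: real) ^ k = (-1) ^ j * (-1) ^ (k - j)" by (simp only: power_add[symmetric]) simp
    thus "(-1) ^ k * basis_coeff F n k * (falling \<alpha> (k - j) / fact (k - j))
        = (-1) ^ j * (basis_coeff F n k * (pochhammer (- \<alpha>) (k - j) / fact (k - j)))"
      by (simp add: pochhammer_minus_falling)
  qed
  finally have "(-1) ^ j * (psi F n / fact n * (fdiff ^^ j) (poly (P n)) \<alpha>)
      = (\<Sum>k=j..n. basis_coeff F n k * (pochhammer (- \<alpha>) (k - j) / fact (k - j)))" by simp
  hence "mu F ^ n * ((-1) ^ j * (psi F n / fact n * (fdiff ^^ j) (poly (P n)) \<alpha>))
      = mu F ^ n * (\<Sum>k=j..n. basis_coeff F n k * (pochhammer (- \<alpha>) (k - j) / fact (k - j)))"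
    by (rule arg_cong)
  thus ?thesis by (simp only: scaled_diff_def scale_def mult_ac)
qed

lemma scaled_diff_lower_bound:
  assumes "\<alpha> < 0"
  shows "\<exists>C M. C > 0 \<and> (\<forall>n\<ge>j. 1 \<le> C * (real n + 1) ^ M * \<bar>scaled_diff j \<alpha> n\<bar>)"
proof -
  obtain C M where C: "C > 0" and bound:
    "\<And>n. n \<ge> j \<Longrightarrow> 1 \<le> C * (real n + 1) ^ M * (mu F ^ n * (\<Sum>k=j..n. basis_coeff F n k))"
    using sum_basis_coeff_lower_bound[OF admissible] by blast
  have \<mu>: "mu F > 0" by (rule mu_pos[OF admissible])
  define m where "m = min 1 (- \<alpha>)"
  have m: "m > 0" using assms by (simp add: m_def)
  have "1 \<le> C / m * (real n + 1) ^ (M + 1) * \<bar>scaled_diff j \<alpha> n\<bar>" if n: "n \<ge> j" for n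
  proof -
    have "m / (real n + 1) * (\<Sum>k=j..n. basis_coeff F n k)
        \<le> (\<Sum>k=j..n. basis_coeff F n k * (pochhammer (- \<alpha>) (k - j) / fact (k - j)))"
      unfolding sum_distrib_left
    proof (intro sum_mono)
      fix k assume k: "k \<in> {j..n}"
      hence b: "basis_coeff F n k > 0" using basis_coeff_pos[OF admissible] by simp
      have "m / (real n + 1) \<le> m / (real (k - j) + 1)" using k m by (intro divide_left_mono) auto
      also have "\<dots> \<le> pochhammer (- \<alpha>) (k - j) / fact (k - j)"
        unfolding m_def using assms by (intro pochhammer_over_fact_ge) auto
      finally show "m / (real n + 1) * basis_coeff F n k
          \<le> basis_coeff F n k * (pochhammer (- \<alpha>) (k - j) / fact (k - j))"
        using b by (metis mult.commute mult_left_mono less_imp_le)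
    qed
    hence "mu F ^ n * (m / (real n + 1) * (\<Sum>k=j..n. basis_coeff F n k)) \<le> (-1) ^ j * scaled_diff j \<alpha> n"
      unfolding scaled_diff_eq_sum using \<mu> by (intro mult_left_mono) auto
    also have "\<dots> \<le> \<bar>scaled_diff j \<alpha> n\<bar>"
      using abs_ge_self[of "(-1) ^ j * scaled_diff j \<alpha> n"] by (simp add: abs_mult)
    finally have "C / m * (real n + 1) ^ (M + 1) * (mu F ^ n * (m / (real n + 1) * (\<Sum>k=j..n. basis_coeff F n k)))
        \<le> C / m * (real n + 1) ^ (M + 1) * \<bar>scaled_diff j \<alpha> n\<bar>"
      using C m by (intro mult_left_mono) auto
    moreover have "C / m * (real n + 1) ^ (M + 1) * (mu F ^ n * (m / (real n + 1) * (\<Sum>k=j..n. basis_coeff F n k)))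
        = C * (real n + 1) ^ M * (mu F ^ n * (\<Sum>k=j..n. basis_coeff F n k))"
      using m by (simp add: divide_simps)
    ultimately show ?thesis using bound[OF n] by linarith
  qed
  moreover have "C / m > 0" using C m by simp
  ultimately show ?thesis by blast
qed

lemma scaled_diff_nonzero:
  assumes "\<alpha> < 0" "n \<ge> j"
  shows "scaled_diff j \<alpha> n \<noteq> 0"
proof
  assume "scaled_diff j \<alpha> n = 0"
  moreover obtain C :: real and M where "\<And>n. n \<ge> j \<Longrightarrow> 1 \<le> C * (real n + 1) ^ M * \<bar>scaled_diff j \<alpha> n\<bar>"
    using scaled_diff_lower_bound[OF assms(1)] by blast
  ultimately show False using assms(2) by fastforce
qed

lemma moderate_inverse_scaled_diff:
  assumes "\<alpha> < 0"
  shows "moderate (\<lambda>n. inverse (scaled_diff j \<alpha> n))"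
proof -
  obtain C M where C: "C > 0" and bound: "\<And>n. n \<ge> j \<Longrightarrow> 1 \<le> C * (real n + 1) ^ M * \<bar>scaled_diff j \<alpha> n\<bar>"
    using scaled_diff_lower_bound[OF assms] by blast
  have "norm (inverse (scaled_diff j \<alpha> n)) \<le> C * (real n + 1) ^ M" for n
  proof (cases "n \<ge> j")
    case True
    have "\<bar>scaled_diff j \<alpha> n\<bar> > 0" using scaled_diff_nonzero[OF assms True] by simp
    thus ?thesis using bound[OF True] by (simp add: field_simps)
  next
    case False
    thus ?thesis using C by (simp add: scaled_diff_eq_0)
  qed
  thus ?thesis by (rule moderateI)
qed

text \<open>
  In both families \<open>psi F n\<close> is the \<open>n\<close>-th power of a constant.
\<close>

lemma psi_Suc: "psi F (Suc n) = psi F 1 * psi F n"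
proof (cases F)
  case (Meixner \<gamma> \<mu>)
  have "basis_coeff F n n = (1 / \<mu> - 1) ^ n" for n
    using pochhammer_pos[of \<gamma> n] admissible Meixner by simp
  thus ?thesis
    by (simp only: psi_eq_basis_coeff[OF admissible] power_Suc power_one_right mult_ac)
next
  case (Charlier \<mu>)
  hence "basis_coeff F n n = (1 / \<mu>) ^ n" for n by simp
  thus ?thesis
    by (simp only: psi_eq_basis_coeff[OF admissible] power_Suc power_one_right mult_ac)
qed

lemma moderate_scale_ratio: "moderate (\<lambda>n. scale n / scale (Suc n))"
proof -
  have "scale n / scale (Suc n) = inverse (psi F 1 * mu F) * (real n + 1) ^ 1" for n
    using psi_nonzero[OF admissible] mu_pos[OF admissible]
    by (simp add: scale_def psi_Suc[of n] field_simps del: psi.simps)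
  thus ?thesis using moderate_mult[OF moderate_const moderate_power_Suc] by (simp only:)
qed

end

section \<open>The generating function\<close>

text \<open>
  As a function of its second argument the kernel is, by Christoffel--Darboux, a quotient with
  denominator \<open>x - z\<close> and numerator a combination of \<open>P n\<close> and \<open>P (Suc n)\<close>; taking \<open>j\<close> differences
  of the quotient in \<open>z\<close> gives the two coefficients.
\<close>

lemma kernel_eq_coeff_A_coeff_B:
  assumes F: "admissible F" and P: "monic_orthogonal (inner_prod F) P"
    and nz: "falling (x - y) (j + 1) \<noteq> 0"
  shows "kernel F P 0 j n x y
       = coeff_A F P j (Suc n) x y * cpoly (P (Suc n)) x + coeff_B F P j (Suc n) x y * cpoly (P n) x"
proof -
  interpret poly_inner_product "inner_prod F" by (rule classical_poly_inner_product[OF F])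
  define h where "h = (\<lambda>k. complex_of_real (norm_sq F P k))"
  have h: "h k \<noteq> 0" for k using norm_pos[OF P, of k] by (simp add: h_def norm_sq_def)
  define g where "g = (\<lambda>z. \<Sum>k\<le>n. cpoly (P k) x / h k * cpoly (P k) z)"
  let ?A = "cpoly (P (Suc n)) x / h n" and ?B = "cpoly (P n) x / h n"
  have "(x - z) * g z = ?A * cpoly (P n) z - ?B * cpoly (P (Suc n)) z" for z
  proof -
    have "g z = (\<Sum>k\<le>n. cpoly (P k) x * cpoly (P k) z / h k)" by (simp add: g_def)
    hence "h n * ((x - z) * g z)
        = cpoly (P (Suc n)) x * cpoly (P n) z - cpoly (P n) x * cpoly (P (Suc n)) z"
      using christoffel_darboux[OF P inner_prod_mult_X, of n x z] by (simp only: h_def norm_sq_def)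
    thus ?thesis using h[of n] by (simp add: field_simps)
  qed
  hence lin: "(\<lambda>z. (x - z) * g z) = (\<lambda>z. ?A * cpoly (P n) z + (- ?B) * cpoly (P (Suc n)) z)"
    by (simp add: fun_eq_iff)
  have D: "(fdiff ^^ k) (\<lambda>z. (x - z) * g z) y
      = ?A * (fdiff ^^ k) (cpoly (P n)) y + (- ?B) * (fdiff ^^ k) (cpoly (P (Suc n))) y" for k
    unfolding lin fdiff_iter_eq_sum[of k] sum_distrib_left sum.distrib[symmetric]
    by (intro sum.cong refl) (simp only: algebra_simps)
  let ?u = "\<Sum>k\<le>j. (fdiff ^^ k) (cpoly (P n)) y / fact k * falling (x - y) k"
  let ?v = "\<Sum>k\<le>j. (fdiff ^^ k) (cpoly (P (Suc n))) y / fact k * falling (x - y) k"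
  have "kernel F P 0 j n x y = (fdiff ^^ j) g y"
    unfolding g_def fdiff_iter_linear kernel_def h_def by simp
  moreover have "falling (x - y) (Suc j) * (fdiff ^^ j) g y = fact j * (?A * ?u + (- ?B) * ?v)"
    unfolding falling_mult_fdiff_iter D sum_distrib_left sum.distrib[symmetric]
    by (intro sum.cong refl) (simp add: add_divide_distrib diff_divide_distrib algebra_simps)
  ultimately have "kernel F P 0 j n x y = fact j * (?A * ?u + (- ?B) * ?v) / falling (x - y) (Suc j)"
    using nz by (simp add: eq_divide_eq mult.commute)
  also have "\<dots> = coeff_A F P j (Suc n) x y * cpoly (P (Suc n)) x
      + coeff_B F P j (Suc n) x y * cpoly (P n) x"
  proof -
    have "coeff_A F P j (Suc n) x y = fact j / (h n * falling (x - y) (Suc j)) * ?u"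
      by (simp add: coeff_A_def h_def)
    moreover have "coeff_B F P j (Suc n) x y = - (fact j / (h n * falling (x - y) (Suc j))) * ?v"
      by (simp add: coeff_B_def h_def)
    moreover have "a * (p / hn * u + (- (q / hn)) * w) / d = a / (hn * d) * u * p + - (a / (hn * d)) * w * q"
      for a p q u w hn d :: complex
      by (simp add: add_divide_distrib diff_divide_distrib distrib_left right_diff_distrib mult_ac)
    ultimately show ?thesis by (simp only:)
  qed
  finally show ?thesis .
qed

locale sobolev_family = classical_family +
  fixes S :: "nat \<Rightarrow> real poly" and j :: nat and \<alpha> lam :: real
  assumes \<alpha>: "\<alpha> < 0" and lam: "lam > 0"
    and S: "monic_orthogonal (sobolev_prod F j \<alpha> lam) S"
begin

abbreviation "\<mu> \<equiv> mu F"

lemma \<mu>: "\<mu> > 0"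
  by (rule mu_pos[OF admissible])

lemma norm_sq_pos: "norm_sq F P n > 0"
  unfolding norm_sq_def
  by (rule poly_inner_product.norm_pos[OF classical_poly_inner_product[OF admissible] P])

text \<open>
  Writing the kernels in terms of \<open>scale k * P k\<close> and \<open>scaled_diff j \<alpha> k\<close> replaces \<open>1 / norm_sq k\<close>
  by these positive weights.
\<close>

definition kernel_weight :: "nat \<Rightarrow> real" where
  "kernel_weight n = 1 / ((scale n)\<^sup>2 * norm_sq F P n)"

text \<open>
  The denominator \<open>1 + lam * K n\<close> of \<open>\<Omega> (Suc n)\<close>, where \<open>K n\<close> is the kernel with both differences
  taken at \<open>\<alpha>\<close>; see \<open>kernel_j_j\<close>.
\<close>

definition denom :: "nat \<Rightarrow> real" where
  "denom n = 1 + lam * (\<Sum>k\<le>n. (scaled_diff j \<alpha> k)\<^sup>2 * kernel_weight k)"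

lemma kernel_weight_pos: "kernel_weight n > 0"
  using scale_nonzero norm_sq_pos by (simp add: kernel_weight_def)

lemma denom_ge: "denom n \<ge> 1" "denom n \<ge> lam * (\<Sum>k\<le>n. (scaled_diff j \<alpha> k)\<^sup>2 * kernel_weight k)"
proof -
  have "(\<Sum>k\<le>n. (scaled_diff j \<alpha> k)\<^sup>2 * kernel_weight k) \<ge> 0"
    using kernel_weight_pos by (intro sum_nonneg mult_nonneg_nonneg) (auto intro: less_imp_le)
  thus "denom n \<ge> 1" using lam by (simp add: denom_def)
qed (simp add: denom_def)

lemma denom_pos: "denom n > 0"
  using denom_ge(1)[of n] by linarith

lemma fdiff_iter_cpoly_alpha:
  "(fdiff ^^ k) (cpoly (P n)) (of_real \<alpha>) = of_real (scaled_diff k \<alpha> n / scale n)"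
  using scale_nonzero[of n] by (simp add: fdiff_iter_cpoly_of_real scaled_diff_def)

lemma norm_sq_eq: "norm_sq F P n = 1 / ((scale n)\<^sup>2 * kernel_weight n)"
  using scale_nonzero[of n] norm_sq_pos[of n] by (simp add: kernel_weight_def)

lemma inverse_norm_sq: "1 / norm_sq F P n = (scale n)\<^sup>2 * kernel_weight n"
  using scale_nonzero[of n] norm_sq_pos[of n] by (simp add: kernel_weight_def)

lemma kernel_0_j:
  "kernel F P 0 j n x (of_real \<alpha>) =
     (\<Sum>k\<le>n. (of_real (scale k) * cpoly (P k) x) * of_real (scaled_diff j \<alpha> k * kernel_weight k))"
  unfolding kernel_def fdiff_iter_cpoly_alpha norm_sq_eq
proof (intro sum.cong refl)
  fix k
  show "(fdiff ^^ 0) (cpoly (P k)) x * of_real (scaled_diff j \<alpha> k / scale k) / of_real (1 / ((scale k)\<^sup>2 * kernel_weight k))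
      = (of_real (scale k) * cpoly (P k) x) * of_real (scaled_diff j \<alpha> k * kernel_weight k)"
    using scale_nonzero[of k] by (simp add: power2_eq_square)
qed

lemma kernel_j_j:
  "1 + of_real lam * kernel F P j j n (of_real \<alpha>) (of_real \<alpha>) = of_real (denom n)"
proof -
  have "kernel F P j j n (of_real \<alpha>) (of_real \<alpha>) = (\<Sum>k\<le>n. of_real ((scaled_diff j \<alpha> k)\<^sup>2 * kernel_weight k))"
    unfolding kernel_def fdiff_iter_cpoly_alpha norm_sq_eq
  proof (intro sum.cong refl)
    fix k
    show "complex_of_real (scaled_diff j \<alpha> k / scale k) * of_real (scaled_diff j \<alpha> k / scale k)
          / of_real (1 / ((scale k)\<^sup>2 * kernel_weight k)) = of_real ((scaled_diff j \<alpha> k)\<^sup>2 * kernel_weight k)"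
      using scale_nonzero[of k] by (simp add: power2_eq_square)
  qed
  thus ?thesis by (simp add: denom_def)
qed

lemma Omega_Suc:
  "Omega F P j \<alpha> lam (Suc n) = of_real (scaled_diff j \<alpha> (Suc n) / (scale (Suc n) * denom n))"
  by (simp add: Omega_def kernel_j_j fdiff_iter_cpoly_alpha del: funpow.simps)

lemma cpoly_S_0: "cpoly (S 0) x = cpoly (P 0) x"
  using sobolev_eq[OF classical_poly_inner_product[OF admissible] lam P S, of 0] by simp

lemma cpoly_S_Suc:
  "cpoly (S (Suc n)) x =
     cpoly (P (Suc n)) x - of_real lam * (Omega F P j \<alpha> lam (Suc n) * kernel F P 0 j n x (of_real \<alpha>))"
proof -
  let ?d = "\<lambda>k. (fdiff ^^ j) (poly (P k)) \<alpha>"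
  have "S (Suc n) = P (Suc n) - smult (lam * (?d (Suc n) / (1 + lam * (\<Sum>k\<le>n. ?d k * ?d k / norm_sq F P k))))
      (\<Sum>k\<le>n. smult (?d k / norm_sq F P k) (P k))"
    using sobolev_eq[OF classical_poly_inner_product[OF admissible] lam P S, of "Suc n"]
    by (simp only: lessThan_Suc_atMost)
  thus ?thesis
    by (simp add: Omega_def kernel_def fdiff_iter_cpoly_of_real mult.assoc)
       (simp add: mult_ac)
qed

text \<open>
  Since the inverse of \<open>scaled_diff j \<alpha> k\<close> has moderate growth, \<open>scale k * P k(x)\<close> is at most
  \<open>C * (n + 1) ^ M\<close> times \<open>scaled_diff j \<alpha> k\<close> for \<open>k \<le> n\<close> wherever the latter is not zero. Hence
  the mixed kernel at \<open>(x, \<alpha>)\<close> is at most \<open>C * (n + 1) ^ M\<close> times the kernel at \<open>(\<alpha>, \<alpha>)\<close>, and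
  \<open>lam\<close> times the latter is bounded by \<open>denom n\<close>.
\<close>

lemma moderate_R:
  "moderate (\<lambda>n. of_real (scaled_diff j \<alpha> (Suc n) / denom n) * kernel F P 0 j n x (of_real \<alpha>))"
proof -
  define X where "X = (\<lambda>n. of_real (scale n) * cpoly (P n) x)"
  have X: "of_real (scale n) * cpoly (P n) x = X n" for n by (simp add: X_def)
  have "moderate (\<lambda>n. X n * of_real (inverse (scaled_diff j \<alpha> n)))"
    unfolding X_def
    by (intro moderate_mult moderate_scaled_cpoly) (simp only: moderate_of_real_iff moderate_inverse_scaled_diff[OF \<alpha>])
  then obtain C M where C: "C \<ge> 0"
    and bound: "\<And>n. norm (X n * of_real (inverse (scaled_diff j \<alpha> n))) \<le> C * (real n + 1) ^ M"
    using moderateE by blast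
  have "norm (kernel F P 0 j n x (of_real \<alpha>) / of_real (denom n)) \<le> (C / lam) * (real n + 1) ^ M" for n
  proof -
    have "norm (kernel F P 0 j n x (of_real \<alpha>))
        \<le> (\<Sum>k\<le>n. C * (real n + 1) ^ M * ((scaled_diff j \<alpha> k)\<^sup>2 * kernel_weight k))"
      unfolding kernel_0_j X
    proof (rule sum_norm_le)
      fix k assume k: "k \<in> {..n}"
      show "norm (X k * of_real (scaled_diff j \<alpha> k * kernel_weight k)) \<le> C * (real n + 1) ^ M * ((scaled_diff j \<alpha> k)\<^sup>2 * kernel_weight k)"
      \<comment> \<open>For \<open>k < j\<close> the difference vanishes, and with it the summand.\<close>
      proof (cases "scaled_diff j \<alpha> k = 0")
        case False
        have "X k * of_real (scaled_diff j \<alpha> k * kernel_weight k)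
            = (X k * of_real (inverse (scaled_diff j \<alpha> k))) * of_real ((scaled_diff j \<alpha> k)\<^sup>2 * kernel_weight k)"
          using False by (simp add: power2_eq_square)
        hence "norm (X k * of_real (scaled_diff j \<alpha> k * kernel_weight k))
            = norm (X k * of_real (inverse (scaled_diff j \<alpha> k))) * ((scaled_diff j \<alpha> k)\<^sup>2 * kernel_weight k)"
          using kernel_weight_pos[of k]
          by (simp only: norm_mult[of "X k * of_real (inverse _)"] norm_of_real) (simp add: abs_mult)
        also have "\<dots> \<le> C * (real k + 1) ^ M * ((scaled_diff j \<alpha> k)\<^sup>2 * kernel_weight k)"
          using kernel_weight_pos[of k] by (intro mult_right_mono bound) auto
        also have "\<dots> \<le> C * (real n + 1) ^ M * ((scaled_diff j \<alpha> k)\<^sup>2 * kernel_weight k)"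
          using kernel_weight_pos[of k] k C by (intro mult_right_mono mult_left_mono power_mono) auto
        finally show ?thesis .
      qed simp
    qed
    also have "\<dots> = C * (real n + 1) ^ M * (\<Sum>k\<le>n. (scaled_diff j \<alpha> k)\<^sup>2 * kernel_weight k)"
      by (simp add: sum_distrib_left)
    also have "\<dots> \<le> C * (real n + 1) ^ M * (denom n / lam)"
      using C lam denom_ge(2)[of n] by (intro mult_left_mono) (auto simp: field_simps)
    finally show ?thesis
      using denom_pos[of n] lam by (simp add: norm_divide divide_le_eq mult_ac)
  qed
  hence "moderate (\<lambda>n. kernel F P 0 j n x (of_real \<alpha>) / of_real (denom n))" by (rule moderateI)
  moreover have "moderate (\<lambda>n. complex_of_real (scaled_diff j \<alpha> (Suc n)))"
    unfolding moderate_of_real_iff by (rule moderate_Suc[OF moderate_scaled_diff])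
  ultimately have "moderate (\<lambda>n. of_real (scaled_diff j \<alpha> (Suc n)) * (kernel F P 0 j n x (of_real \<alpha>) / of_real (denom n)))"
    by (rule moderate_mult[rotated])
  thus ?thesis by simp
qed

text \<open>
  The last summand of \<open>denom n\<close> alone gives \<open>denom n \<ge> lam * (scaled_diff j \<alpha> n)\<^sup>2 * kernel_weight n\<close>.
\<close>

lemma moderate_weight_over_denom: "moderate (\<lambda>n. kernel_weight n / denom n)"
proof (rule moderate_le)
  show "moderate (\<lambda>n. (1 / lam) * (inverse (scaled_diff j \<alpha> n) * inverse (scaled_diff j \<alpha> n)))"
    by (intro moderate_mult moderate_const moderate_inverse_scaled_diff \<alpha>)
  have "norm (kernel_weight n / denom n) \<le> norm ((1 / lam) * (inverse (scaled_diff j \<alpha> n) * inverse (scaled_diff j \<alpha> n)))"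
    if "n \<ge> j" for n
  proof -
    let ?q = "(scaled_diff j \<alpha> n)\<^sup>2"
    have q: "?q > 0" using scaled_diff_nonzero[OF \<alpha> that] by simp
    have "?q * kernel_weight n \<le> (\<Sum>k\<le>n. (scaled_diff j \<alpha> k)\<^sup>2 * kernel_weight k)"
      using kernel_weight_pos by (intro member_le_sum mult_nonneg_nonneg) (auto intro: less_imp_le)
    hence "lam * (?q * kernel_weight n) \<le> denom n"
      using lam denom_ge(2)[of n] by (meson mult_left_mono less_imp_le order_trans)
    hence "kernel_weight n / denom n \<le> 1 / (lam * ?q)"
      using q lam denom_pos[of n] by (simp add: divide_le_eq le_divide_eq mult_ac)
    moreover have "0 \<le> kernel_weight n / denom n" using kernel_weight_pos[of n] denom_pos[of n] by simp
    moreover have "norm ((1 / lam) * (inverse (scaled_diff j \<alpha> n) * inverse (scaled_diff j \<alpha> n))) = 1 / (lam * ?q)"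
      using lam by (simp add: power2_eq_square abs_mult inverse_eq_divide)
    ultimately show ?thesis by simp
  qed
  thus "\<forall>\<^sub>F n in sequentially. norm (kernel_weight n / denom n)
      \<le> norm ((1 / lam) * (inverse (scaled_diff j \<alpha> n) * inverse (scaled_diff j \<alpha> n)))"
    unfolding eventually_sequentially by blast
qed

context
  fixes t :: complex assumes t: "norm t < \<mu>"
begin

lemma norm_t_over_mu: "norm (t / of_real \<mu>) < 1"
  using t \<mu> by (simp add: norm_divide)

lemma psi_power: "of_real (psi F n) / fact n * t ^ n = of_real (scale n) * (t / of_real \<mu>) ^ n"
  using \<mu> by (simp add: scale_def power_divide)

lemma summable_gen_term_P: "summable (gen_term F P x t)"
proof -
  have "gen_term F P x t = (\<lambda>n. (of_real (scale n) * cpoly (P n) x) * (t / of_real \<mu>) ^ n)"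
  proof
    fix n
    have "gen_term F P x t n = cpoly (P n) x * (of_real (psi F n) / fact n * t ^ n)"
      by (simp add: gen_term_def)
    also have "\<dots> = (of_real (scale n) * cpoly (P n) x) * (t / of_real \<mu>) ^ n"
      unfolding psi_power by simp
    finally show "gen_term F P x t n = \<dots>" .
  qed
  thus ?thesis
    by (simp only:) (intro summable_moderate_power moderate_scaled_cpoly norm_t_over_mu)
qed

lemma summable_Suc_power:
  fixes f :: "nat \<Rightarrow> complex"
  assumes "moderate f"
  shows "summable (\<lambda>n. f n * (t / of_real \<mu>) ^ Suc n)"
  using summable_mult2[OF summable_moderate_power[OF assms norm_t_over_mu], of "t / of_real \<mu>"]
  by (simp add: mult_ac)

lemma summable_R_term: "summable (\<lambda>n. R_term F P j \<alpha> lam x t (Suc n))"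
proof -
  have "R_term F P j \<alpha> lam x t (Suc n)
      = of_real (scaled_diff j \<alpha> (Suc n) / denom n) * kernel F P 0 j n x (of_real \<alpha>) * (t / of_real \<mu>) ^ Suc n" for n
  proof -
    have "R_term F P j \<alpha> lam x t (Suc n)
        = Omega F P j \<alpha> lam (Suc n) * kernel F P 0 j n x (of_real \<alpha>) * (of_real (psi F (Suc n)) / fact (Suc n) * t ^ Suc n)"
      by (simp only: R_term_def diff_Suc_1) (simp add: mult_ac del: fact_Suc psi.simps power_Suc)
    also have "\<dots> = of_real (scaled_diff j \<alpha> (Suc n) / denom n) * kernel F P 0 j n x (of_real \<alpha>) * (t / of_real \<mu>) ^ Suc n"
      unfolding psi_power Omega_Suc using scale_nonzero[of "Suc n"]
      by (simp del: power_Suc)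
    finally show ?thesis .
  qed
  thus ?thesis by (simp only:) (rule summable_Suc_power[OF moderate_R])
qed

lemma gen_term_S_Suc:
  "gen_term F S x t (Suc n) = gen_term F P x t (Suc n) - of_real lam * R_term F P j \<alpha> lam x t (Suc n)"
  unfolding gen_term_def R_term_def cpoly_S_Suc by (simp add: algebra_simps del: fact_Suc psi.simps power_Suc)

lemma gen_fun_S:
  "summable (gen_term F S x t)"
  "gen_fun F S x t = gen_fun F P x t - of_real lam * R_fun F P j \<alpha> lam x t"
proof -
  have P: "(\<lambda>n. gen_term F P x t (Suc n)) sums (gen_fun F P x t - gen_term F P x t 0)"
    using summable_sums[OF summable_gen_term_P[of x]] unfolding gen_fun_def[symmetric]
    by (simp only: sums_Suc_iff) simp
  have "(\<lambda>n. gen_term F S x t (Suc n)) sums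
      (gen_fun F P x t - gen_term F P x t 0 - of_real lam * R_fun F P j \<alpha> lam x t)"
    unfolding gen_term_S_Suc R_fun_def
    by (intro sums_diff P sums_mult summable_sums summable_R_term)
  moreover have "gen_term F P x t 0 = gen_term F S x t 0" by (simp add: gen_term_def cpoly_S_0)
  ultimately have "gen_term F S x t sums (gen_fun F P x t - of_real lam * R_fun F P j \<alpha> lam x t)"
    by (simp add: sums_Suc_iff)
  thus "summable (gen_term F S x t)"
    "gen_fun F S x t = gen_fun F P x t - of_real lam * R_fun F P j \<alpha> lam x t"
    by (simp_all add: gen_fun_def sums_iff)
qed

lemma moderate_fdiff_sum:
  fixes x :: complex
  shows "moderate (\<lambda>n. \<Sum>k\<le>j. of_real (scaled_diff k \<alpha> n) / fact k * falling (x - of_real \<alpha>) k)"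
proof (rule moderate_sum)
  fix k
  have "moderate (\<lambda>n. complex_of_real (scaled_diff k \<alpha> n))"
    unfolding moderate_of_real_iff by (rule moderate_scaled_diff)
  hence "moderate (\<lambda>n. of_real (scaled_diff k \<alpha> n) * (falling (x - of_real \<alpha>) k / fact k))"
    by (rule moderate_mult[OF _ moderate_const])
  thus "moderate (\<lambda>n. of_real (scaled_diff k \<alpha> n) / fact k * falling (x - of_real \<alpha>) k)" by simp
qed simp

text \<open>
  What \<open>A_term\<close> and \<open>B_term\<close> have in common: the factor \<open>\<Omega>\<close>, the inverse squared norm and the
  change of normalisation between consecutive indices.
\<close>

lemma moderate_common_factor:
  "moderate (\<lambda>n. complex_of_real (scaled_diff j \<alpha> (Suc n) * (kernel_weight n / denom n) * (scale n / scale (Suc n))))"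
  unfolding moderate_of_real_iff
  by (intro moderate_mult moderate_weight_over_denom moderate_scale_ratio moderate_Suc[OF moderate_scaled_diff])

lemma summable_A_term: "summable (\<lambda>n. A_term F P j \<alpha> lam x t (Suc n))"
proof -
  define c where "c = fact j / falling (x - of_real \<alpha>) (j + 1)"
  define U where "U = (\<lambda>n. \<Sum>k\<le>j. of_real (scaled_diff k \<alpha> n) / fact k * falling (x - of_real \<alpha>) k)"
  define W where "W = (\<lambda>n. complex_of_real (scaled_diff j \<alpha> (Suc n) * (kernel_weight n / denom n) * (scale n / scale (Suc n))))"
  have "A_term F P j \<alpha> lam x t (Suc n) =
      (W n * U n * (of_real (scale (Suc n)) * cpoly (P (Suc n)) x) * c) * (t / of_real \<mu>) ^ Suc n" for n
  proof -
    have U: "(\<Sum>k\<le>j. (fdiff ^^ k) (cpoly (P n)) (of_real \<alpha>) / fact k * falling (x - of_real \<alpha>) k)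
        = U n / of_real (scale n)"
      unfolding U_def sum_divide_distrib fdiff_iter_cpoly_alpha by (intro sum.cong) simp_all
    have A: "coeff_A F P j (Suc n) x (of_real \<alpha>) = c * of_real ((scale n)\<^sup>2 * kernel_weight n) * (U n / of_real (scale n))"
      by (simp only: coeff_A_def diff_Suc_1 U inverse_norm_sq[symmetric]) (simp add: c_def)
    have "A_term F P j \<alpha> lam x t (Suc n)
        = Omega F P j \<alpha> lam (Suc n) * coeff_A F P j (Suc n) x (of_real \<alpha>) * cpoly (P (Suc n)) x *
          (of_real (psi F (Suc n)) / fact (Suc n) * t ^ Suc n)"
      unfolding A_term_def by (simp add: mult_ac del: fact_Suc psi.simps power_Suc)
    also have "\<dots> = (W n * U n * (of_real (scale (Suc n)) * cpoly (P (Suc n)) x) * c) * (t / of_real \<mu>) ^ Suc n"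
      unfolding psi_power Omega_Suc A W_def using scale_nonzero[of "Suc n"] scale_nonzero[of n]
      by (simp add: power2_eq_square mult_ac del: power_Suc)
    finally show ?thesis .
  qed
  moreover have "moderate (\<lambda>n. W n * U n * (of_real (scale (Suc n)) * cpoly (P (Suc n)) x) * c)"
    unfolding W_def U_def
    by (intro moderate_mult moderate_const moderate_fdiff_sum moderate_common_factor
          moderate_Suc[OF moderate_scaled_cpoly])
  ultimately show ?thesis by (simp only:) (rule summable_Suc_power)
qed

lemma summable_B_term: "summable (B_term F P j \<alpha> lam x t)"
proof -
  define c where "c = - (fact j / falling (x - of_real \<alpha>) (j + 1))"
  define U where "U = (\<lambda>n. \<Sum>k\<le>j. of_real (scaled_diff k \<alpha> n) / fact k * falling (x - of_real \<alpha>) k)"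
  define W where "W = (\<lambda>n. complex_of_real (scaled_diff j \<alpha> (Suc n) * (kernel_weight n / denom n) * (scale n / scale (Suc n))))"
  have B_eq: "B_term F P j \<alpha> lam x t n =
      (W n * U (Suc n) * (of_real (scale n) * cpoly (P n) x) * (c / of_real \<mu>)) * (t / of_real \<mu>) ^ n" for n
  proof -
    have U: "(\<Sum>k\<le>j. (fdiff ^^ k) (cpoly (P (Suc n))) (of_real \<alpha>) / fact k * falling (x - of_real \<alpha>) k)
        = U (Suc n) / of_real (scale (Suc n))"
      unfolding U_def sum_divide_distrib fdiff_iter_cpoly_alpha by (intro sum.cong) simp_all
    have B: "coeff_B F P j (Suc n) x (of_real \<alpha>) = c * of_real ((scale n)\<^sup>2 * kernel_weight n) * (U (Suc n) / of_real (scale (Suc n)))"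
      by (simp only: coeff_B_def diff_Suc_1 U inverse_norm_sq[symmetric]) (simp add: c_def)
    have psi: "of_real (psi F (Suc n)) / fact (Suc n) * t ^ n
        = of_real (scale (Suc n)) / of_real \<mu> * (t / of_real \<mu>) ^ n"
      using \<mu> by (simp add: scale_def power_divide del: psi.simps fact_Suc)
    have "B_term F P j \<alpha> lam x t n
        = Omega F P j \<alpha> lam (Suc n) * coeff_B F P j (Suc n) x (of_real \<alpha>) * cpoly (P n) x *
          (of_real (psi F (Suc n)) / fact (Suc n) * t ^ n)"
      unfolding B_term_def by (simp add: mult_ac del: fact_Suc psi.simps)
    also have "\<dots> = (W n * U (Suc n) * (of_real (scale n) * cpoly (P n) x) * (c / of_real \<mu>)) * (t / of_real \<mu>) ^ n"
      unfolding psi Omega_Suc B W_def using scale_nonzero[of "Suc n"] scale_nonzero[of n]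
      by (simp add: power2_eq_square mult_ac)
    finally show ?thesis .
  qed
  have "moderate (\<lambda>n. W n * U (Suc n) * (of_real (scale n) * cpoly (P n) x) * (c / of_real \<mu>))"
    unfolding W_def U_def
    by (intro moderate_mult moderate_const moderate_Suc[OF moderate_fdiff_sum] moderate_common_factor
          moderate_scaled_cpoly)
  hence "summable (\<lambda>n. (W n * U (Suc n) * (of_real (scale n) * cpoly (P n) x) * (c / of_real \<mu>))
      * (t / of_real \<mu>) ^ n)"
    by (rule summable_moderate_power[OF _ norm_t_over_mu])
  moreover have "B_term F P j \<alpha> lam x t = (\<lambda>n. (W n * U (Suc n) *
      (of_real (scale n) * cpoly (P n) x) * (c / of_real \<mu>)) * (t / of_real \<mu>) ^ n)"
    by (rule ext) (rule B_eq)
  ultimately show ?thesis by (simp only:)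
qed

lemma R_term_eq_A_term_B_term:
  assumes "falling (x - of_real \<alpha>) (j + 1) \<noteq> 0"
  shows "R_term F P j \<alpha> lam x t (Suc n) = A_term F P j \<alpha> lam x t (Suc n) + t * B_term F P j \<alpha> lam x t n"
proof -
  have "\<psi> * om * (A * p + B * q) * t ^ Suc n = \<psi> * om * A * p * t ^ Suc n + t * (\<psi> * om * B * q * t ^ n)"
    for \<psi> om A B p q :: complex
    by (simp add: algebra_simps)
  thus ?thesis
    unfolding R_term_def A_term_def B_term_def diff_Suc_1 Suc_eq_plus1[symmetric]
      kernel_eq_coeff_A_coeff_B[OF admissible P assms] by blast
qed

lemma R_fun_eq:
  assumes "falling (x - of_real \<alpha>) (j + 1) \<noteq> 0"
  shows "R_fun F P j \<alpha> lam x t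
       = (\<Sum>n. A_term F P j \<alpha> lam x t (Suc n)) + t * (\<Sum>n. B_term F P j \<alpha> lam x t n)"
proof -
  have "(\<lambda>n. A_term F P j \<alpha> lam x t (Suc n) + t * B_term F P j \<alpha> lam x t n) sums
      ((\<Sum>n. A_term F P j \<alpha> lam x t (Suc n)) + t * (\<Sum>n. B_term F P j \<alpha> lam x t n))"
    by (intro sums_add sums_mult summable_sums summable_A_term summable_B_term)
  thus ?thesis
    unfolding R_fun_def R_term_eq_A_term_B_term[OF assms] by (simp add: sums_iff)
qed

end

end

lemma gen_fun_analytic:
  assumes "\<And>t. norm t < r \<Longrightarrow> summable (gen_term F Q x t)"
  shows "gen_fun F Q x analytic_on {t. norm t < r}"
proof -
  have "gen_fun F Q x analytic_on ball 0 r"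
  proof (rule power_series_analytic)
    fix w :: complex assume "w \<in> ball 0 r"
    hence "gen_term F Q x w sums gen_fun F Q x w"
      unfolding gen_fun_def by (intro summable_sums assms) simp
    thus "(\<lambda>n. (of_real (psi F n) / fact n * cpoly (Q n) x) * (w - 0) ^ n) sums gen_fun F Q x w"
      by (simp add: gen_term_def[abs_def])
  qed
  moreover have "ball 0 r = {t :: complex. norm t < r}" by auto
  ultimately show ?thesis by simp
qed

theorem theorem3p6:
  fixes F :: family and P S :: "nat \<Rightarrow> real poly"
    and j :: nat and \<alpha> lam :: real and x :: complex
  assumes "admissible F" and "j \<ge> 1" and "\<alpha> < 0" and "lam > 0"
    and "monic_orthogonal (inner_prod F) P"
    and "monic_orthogonal (sobolev_prod F j \<alpha> lam) S"
  shows "(\<forall>t. norm t < mu F \<longrightarrow>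
            summable (gen_term F S x t) \<and>
            summable (gen_term F P x t) \<and>
            summable (\<lambda>n. R_term F P j \<alpha> lam x t (Suc n)) \<and>
            gen_fun F S x t = gen_fun F P x t - of_real lam * R_fun F P j \<alpha> lam x t)
       \<and> gen_fun F P x analytic_on {t. norm t < mu F}
       \<and> gen_fun F S x analytic_on {t. norm t < mu F}
       \<and> (x - of_real \<alpha> \<notin> of_nat ` {0..j} \<longrightarrow>
           (\<forall>t. norm t < mu F \<longrightarrow>
             summable (\<lambda>n. A_term F P j \<alpha> lam x t (Suc n)) \<and>
             summable (B_term F P j \<alpha> lam x t) \<and>
             gen_fun F S x t = gen_fun F P x t
               - of_real lam * (\<Sum>n. A_term F P j \<alpha> lam x t (Suc n))
               - of_real lam * t * (\<Sum>n. B_term F P j \<alpha> lam x t n)))"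
proof -
  interpret sobolev_family F P S j \<alpha> lam
    by unfold_locales (use assms in auto)
  have "gen_fun F S x t = gen_fun F P x t
               - of_real lam * (\<Sum>n. A_term F P j \<alpha> lam x t (Suc n))
               - of_real lam * t * (\<Sum>n. B_term F P j \<alpha> lam x t n)"
    if "x - of_real \<alpha> \<notin> of_nat ` {0..j}" and t: "norm t < mu F" for t
  proof -
    have "falling (x - of_real \<alpha>) (j + 1) \<noteq> 0"
      using that(1) by (auto simp: falling_def)
    from R_fun_eq[OF t this] show ?thesis
      unfolding gen_fun_S(2)[OF t] by (simp add: algebra_simps)
  qed
  thus ?thesis
    using summable_gen_term_P summable_R_term gen_fun_S summable_A_term summable_B_term
    by (intro conjI allI impI gen_fun_analytic) blast+
qed

end
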